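(* Let $H=\bigsqcup_{i=1}^r H_i$ be a graph with connected components $H_1,\dots,H_r$, $r\geq 1$, let $v\notin V(H)$, and let $G=\operatorname{cone}(v,H)$. If $J_G$ is unmixed, then $H$ has at most two connected components.
   Context: All graphs are finite and simple; $\sqcup$ denotes disjoint union of graphs. For a graph $H$ and $v\notin V(H)$, $\operatorname{cone}(v,H)$ is the graph with vertex set $V(H)\cup\{v\}$ and edge set $E(H)\cup\{\{u,v\}:u\in V(H)\}$. Let $K$ be a field. The binomial edge ideal $J_G$ of a graph $G$ is the ideal of the polynomial ring $K[x_i,y_i: i\in V(G)]$ generated by the binomials $x_iy_j-x_jy_i$, where $\{i,j\}\in E(G)$ and $i<j$ (for a fixed total order on $V(G)$). An ideal is unmixed if all its associated primes have the same height (binomial edge ideals are radical, so these are the minimal primes). *)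

theory Defs
  imports
    "HOL-Algebra.Ideal"
    "HOL-Library.Poly_Mapping"
    "HOL-Library.Extended_Nat"
    "Graph_Theory.Graph_Theory"
begin

section \<open>Graphs\<close>

text \<open>
  Finite simple graphs are Graph_Theory's \<open>pair_graph\<close>s: finite, loop-free, symmetric
  digraphs, an edge \<open>{u, v}\<close> being the two arcs \<open>(u, v)\<close> and \<open>(v, u)\<close>. As the arc relation is
  symmetric, the strongly connected components are the connected components.
\<close>

definition components :: "'v pair_pre_digraph \<Rightarrow> ('v, 'v \<times> 'v) pre_digraph set" where
  "components H = pre_digraph.sccs (with_proj H)"

definition cone :: "'v \<Rightarrow> 'v pair_pre_digraph \<Rightarrow> 'v pair_pre_digraph" where
  "cone v H = \<lparr> pverts = insert v (pverts H),
               parcs = parcs H \<union> {(u, v) |u. u \<in> pverts H} \<union> {(v, u) |u. u \<in> pverts H} \<rparr>"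

lemma pair_graph_cone:
  assumes "pair_graph H" "v \<notin> pverts H"
  shows "pair_graph (cone v H)"
proof -
  interpret H: pair_graph H by fact
  have sym: "sym (parcs H)"
    using H.pair_sym_arcs by (simp add: symmetric_def)
  show ?thesis
  proof
    fix e assume "e \<in> parcs (cone v H)"
    then have "e \<in> parcs H \<or> (\<exists>u\<in>pverts H. e = (u, v) \<or> e = (v, u))"
      by (auto simp: cone_def)
    then have "fst e \<in> insert v (pverts H) \<and> snd e \<in> insert v (pverts H) \<and> fst e \<noteq> snd e"
      using H.arc_fst_in_verts[of e] H.arc_snd_in_verts[of e] H.pair_no_loops[of e] assms(2)
      by (elim disjE bexE) auto
    then show "fst e \<in> pverts (cone v H)" "snd e \<in> pverts (cone v H)" "fst e \<noteq> snd e"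
      by (simp_all add: cone_def)
  next
    show "finite (pverts (cone v H))" "finite (parcs (cone v H))"
      using H.pair_finite_verts H.pair_finite_arcs by (simp_all add: cone_def)
    show "symmetric (with_proj (cone v H))"
      using sym unfolding symmetric_def with_proj_simps cone_def
      by (auto intro!: symI dest: symD)
  qed
qed


section \<open>Polynomial rings over a set of indeterminates\<close>

text \<open>
  A polynomial is a finitely supported map from monomials to coefficients, a monomial a finitely
  supported map from indeterminates to exponents. \<open>poly_ring A\<close> only contains the polynomials in
  the indeterminates of the set \<open>A\<close>, which need not exhaust the type.
\<close>

definition poly_ring :: "'x set \<Rightarrow> (('x \<Rightarrow>\<^sub>0 nat) \<Rightarrow>\<^sub>0 'k::comm_ring_1) ring" where
  "poly_ring A = \<lparr> carrier = {p. \<forall>m \<in> Poly_Mapping.keys p. Poly_Mapping.keys m \<subseteq> A},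
                   monoid.mult = (*), one = 1, zero = 0, add = (+) \<rparr>"

definition indet :: "'x \<Rightarrow> ('x \<Rightarrow>\<^sub>0 nat) \<Rightarrow>\<^sub>0 'k::comm_ring_1" where
  "indet a = Poly_Mapping.single (Poly_Mapping.single a 1) 1"

lemma cring_poly_ring: "cring (poly_ring A :: (('x \<Rightarrow>\<^sub>0 nat) \<Rightarrow>\<^sub>0 'k::comm_ring_1) ring)"
proof -
  let ?C = "carrier (poly_ring A :: (('x \<Rightarrow>\<^sub>0 nat) \<Rightarrow>\<^sub>0 'k) ring)"
  have add: "p + q \<in> ?C" if "p \<in> ?C" "q \<in> ?C" for p q
    using that Poly_Mapping.keys_add[of p q] by (auto simp: poly_ring_def)
  have mult: "p * q \<in> ?C" if p: "p \<in> ?C" and q: "q \<in> ?C" for p q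
  proof -
    have "Poly_Mapping.keys m \<subseteq> A" if m: "m \<in> Poly_Mapping.keys (p * q)" for m
    proof -
      obtain a b where ab: "m = a + b" "a \<in> Poly_Mapping.keys p" "b \<in> Poly_Mapping.keys q"
        using keys_mult[of p q] m by blast
      have "Poly_Mapping.keys a \<subseteq> A" "Poly_Mapping.keys b \<subseteq> A"
        using p q ab(2,3) by (simp_all add: poly_ring_def)
      then show ?thesis
        using Poly_Mapping.keys_add[of a b] ab(1) by blast
    qed
    then show ?thesis by (simp add: poly_ring_def)
  qed
  have uminus: "- p \<in> ?C" if "p \<in> ?C" for p
    using that by (simp add: poly_ring_def keys_def)
  have zero: "0 \<in> ?C" and one: "1 \<in> ?C"
    by (simp_all add: poly_ring_def)
  note ops = poly_ring_def[of A, THEN arg_cong[where f = ring.add]]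
    poly_ring_def[of A, THEN arg_cong[where f = ring.zero]]
    poly_ring_def[of A, THEN arg_cong[where f = monoid.mult]]
    poly_ring_def[of A, THEN arg_cong[where f = monoid.one]]
  show ?thesis
  proof (rule cringI)
    show "abelian_group (poly_ring A :: (('x \<Rightarrow>\<^sub>0 nat) \<Rightarrow>\<^sub>0 'k) ring)"
    proof (rule abelian_groupI, unfold ops ring.simps monoid.simps)
      show "\<exists>q\<in>?C. q + p = 0" if "p \<in> ?C" for p
        using uminus[OF that] by (intro bexI[of _ "- p"]) simp
    qed (rule add zero add.assoc add.commute add_0 | assumption)+
    show "Group.comm_monoid (poly_ring A :: (('x \<Rightarrow>\<^sub>0 nat) \<Rightarrow>\<^sub>0 'k) ring)"
      by (rule comm_monoidI, unfold ops ring.simps monoid.simps)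
        (rule mult one mult.assoc mult.commute mult_1_left | assumption)+
  qed (unfold ops ring.simps monoid.simps, rule distrib_right)
qed


section \<open>Height, associated primes, unmixed ideals\<close>

definition height :: "('a, 'b) ring_scheme \<Rightarrow> 'a set \<Rightarrow> enat" where
  "height R P = Sup {enat n |n. \<exists>c :: nat \<Rightarrow> 'a set.
     (\<forall>i\<le>n. primeideal (c i) R) \<and> (\<forall>i<n. c i \<subset> c (Suc i)) \<and> c n = P}"

text \<open>
  The associated primes of \<open>I\<close> are those of the module \<open>R/I\<close>: the prime ideals of the form
  \<open>Ann (f + I) = (I : f)\<close>.
\<close>

definition associated_primes :: "('a, 'b) ring_scheme \<Rightarrow> 'a set \<Rightarrow> 'a set set" where
  "associated_primes R I =
     {P. primeideal P R \<and> (\<exists>f\<in>carrier R. P = {a \<in> carrier R. a \<otimes>\<^bsub>R\<^esub> f \<in> I})}"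

definition unmixed :: "('a, 'b) ring_scheme \<Rightarrow> 'a set \<Rightarrow> bool" where
  "unmixed R I \<longleftrightarrow>
     (\<forall>P\<in>associated_primes R I. \<forall>Q\<in>associated_primes R I. height R P = height R Q)"


section \<open>Binomial edge ideals\<close>

datatype 'v edge_var = XVar 'v | YVar 'v

definition edge_ring :: "'v pair_pre_digraph \<Rightarrow> (('v edge_var \<Rightarrow>\<^sub>0 nat) \<Rightarrow>\<^sub>0 'k::field) ring" where
  "edge_ring G = poly_ring (XVar ` pverts G \<union> YVar ` pverts G)"

definition binomial_edge_ideal ::
    "'v::linorder pair_pre_digraph \<Rightarrow> (('v edge_var \<Rightarrow>\<^sub>0 nat) \<Rightarrow>\<^sub>0 'k::field) set" where
  "binomial_edge_ideal G =
     Idl\<^bsub>edge_ring G\<^esub> {indet (XVar i) * indet (YVar j) - indet (XVar j) * indet (YVar i) |i j.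
                        (i, j) \<in> parcs G \<and> i < j}"

end

theory Submission
  imports Defs "HOL-Library.Product_Lexorder"
begin

text \<open>
  Let \<open>H\<close> have \<open>n\<close> vertices and \<open>r \<ge> 2\<close> components. The binomial edge ideal \<open>J\<close> of the cone has two
  associated primes that can be written down explicitly. One is the ideal \<open>P\<close> of all \<open>2 \<times> 2\<close> minors
  of the generic matrix with columns \<open>(x\<^sub>i, y\<^sub>i)\<close>; it belongs to the empty cut set and has height \<open>n\<close>. The
  other, \<open>Q\<close>, belongs to the cut set \<open>{v}\<close>: it is generated by \<open>x\<^sub>v\<close>, \<open>y\<^sub>v\<close>, and the minors within the
  components of \<open>H\<close>, and has height \<open>n + 2 - r\<close>. If \<open>J\<close> is unmixed the heights agree, so \<open>r = 2\<close>.

  Both primes are kernels of monomial maps into a polynomial ring (\<open>toric_kernel\<close>), which makes them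
  prime; \<open>toric_kernel_subset\<close> says that the expected generators suffice. With it, both
  are exhibited as colon ideals of \<open>J\<close> (\<open>toric_kernel_associated\<close>): \<open>P\<close> by the element \<open>x\<^sub>v\<close>, and \<open>Q\<close> by a power
  of the product of the \<open>x\<^sub>i\<close> with \<open>i\<close> in \<open>H\<close> times a minor \<open>x\<^sub>u y\<^sub>w - x\<^sub>w y\<^sub>u\<close> with \<open>u\<close> and \<open>w\<close> in
  different components.

  Only one inequality is needed for each height. The height of \<open>P\<close> is at least \<open>n\<close> because of a chain of
  toric kernels (\<open>height_toric_kernel_ge\<close>). The height of \<open>Q\<close> is at most \<open>n + 2 - r\<close> because the \<open>x\<^sub>i\<close> with
  \<open>i\<close> in \<open>H\<close> and one \<open>y\<^sub>i\<close> from each component, \<open>n + r\<close> of the \<open>2 n + 2\<close> indeterminates, are algebraically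
  independent modulo \<open>Q\<close> (\<open>toric_kernel_indets_independent\<close>, \<open>height_le_if_indets_independent\<close>).
\<close>

section \<open>Ideals of polynomial rings\<close>

lemma poly_ring_simps [simp]:
  "monoid.mult (poly_ring A) = (*)" "monoid.one (poly_ring A) = 1"
  "ring.zero (poly_ring A) = 0" "ring.add (poly_ring A) = (+)"
  by (simp_all add: poly_ring_def)

lemma carrier_poly_ring:
  "p \<in> carrier (poly_ring A) \<longleftrightarrow> (\<forall>m\<in>Poly_Mapping.keys p. Poly_Mapping.keys m \<subseteq> A)"
  by (simp add: poly_ring_def)

lemma poly_ring_a_inv:
  fixes p :: "('x \<Rightarrow>\<^sub>0 nat) \<Rightarrow>\<^sub>0 'k::comm_ring_1"
  assumes "p \<in> carrier (poly_ring A)"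
  shows "- p \<in> carrier (poly_ring A)" "\<ominus>\<^bsub>poly_ring A\<^esub> p = - p"
proof -
  interpret cring "poly_ring A :: (('x \<Rightarrow>\<^sub>0 nat) \<Rightarrow>\<^sub>0 'k) ring" by (rule cring_poly_ring)
  show 1: "- p \<in> carrier (poly_ring A)"
    using assms by (simp add: carrier_poly_ring in_keys_iff)
  show "\<ominus>\<^bsub>poly_ring A\<^esub> p = - p"
    using minus_equality[of "- p" p] assms 1 by simp
qed

lemma poly_ring_closed:
  fixes p q :: "('x \<Rightarrow>\<^sub>0 nat) \<Rightarrow>\<^sub>0 'k::comm_ring_1"
  shows "0 \<in> carrier (poly_ring A :: (('x \<Rightarrow>\<^sub>0 nat) \<Rightarrow>\<^sub>0 'k) ring)"
    "1 \<in> carrier (poly_ring A :: (('x \<Rightarrow>\<^sub>0 nat) \<Rightarrow>\<^sub>0 'k) ring)"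
    "p \<in> carrier (poly_ring A) \<Longrightarrow> q \<in> carrier (poly_ring A) \<Longrightarrow> p + q \<in> carrier (poly_ring A)"
    "p \<in> carrier (poly_ring A) \<Longrightarrow> q \<in> carrier (poly_ring A) \<Longrightarrow> p * q \<in> carrier (poly_ring A)"
    "p \<in> carrier (poly_ring A) \<Longrightarrow> q \<in> carrier (poly_ring A) \<Longrightarrow> p - q \<in> carrier (poly_ring A)"
proof -
  interpret cring "poly_ring A :: (('x \<Rightarrow>\<^sub>0 nat) \<Rightarrow>\<^sub>0 'k) ring" by (rule cring_poly_ring)
  show "0 \<in> carrier (poly_ring A :: (('x \<Rightarrow>\<^sub>0 nat) \<Rightarrow>\<^sub>0 'k) ring)"
    "1 \<in> carrier (poly_ring A :: (('x \<Rightarrow>\<^sub>0 nat) \<Rightarrow>\<^sub>0 'k) ring)"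
    using zero_closed one_closed by simp_all
  show add: "p + q \<in> carrier (poly_ring A)"
    if "p \<in> carrier (poly_ring A)" "q \<in> carrier (poly_ring A)"
    for p q :: "('x \<Rightarrow>\<^sub>0 nat) \<Rightarrow>\<^sub>0 'k"
    using a_closed[OF that] by simp
  show "p * q \<in> carrier (poly_ring A)"
    if "p \<in> carrier (poly_ring A)" "q \<in> carrier (poly_ring A)"
    using m_closed[OF that] by simp
  show "p - q \<in> carrier (poly_ring A)"
    if "p \<in> carrier (poly_ring A)" "q \<in> carrier (poly_ring A)"
    using add[OF that(1) poly_ring_a_inv(1)[OF that(2)]] by simp
qed

lemma poly_ring_power_closed:
  "p \<in> carrier (poly_ring A) \<Longrightarrow> p ^ k \<in> carrier (poly_ring A)"
  by (induction k) (auto intro: poly_ring_closed)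

lemma poly_ring_prod_closed:
  "(\<And>i. i \<in> I \<Longrightarrow> f i \<in> carrier (poly_ring A)) \<Longrightarrow> prod f I \<in> carrier (poly_ring A)"
  by (induction I rule: infinite_finite_induct) (auto intro: poly_ring_closed)

lemma poly_ring_sum_closed:
  "(\<And>i. i \<in> I \<Longrightarrow> f i \<in> carrier (poly_ring A)) \<Longrightarrow> sum f I \<in> carrier (poly_ring A)"
  by (induction I rule: infinite_finite_induct) (auto intro: poly_ring_closed)

lemma single_in_poly_ring: "Poly_Mapping.keys m \<subseteq> A \<Longrightarrow> Poly_Mapping.single m c \<in> carrier (poly_ring A)"
  by (simp add: carrier_poly_ring)

lemma const_in_poly_ring: "Poly_Mapping.single 0 c \<in> carrier (poly_ring A)"
  by (simp add: carrier_poly_ring)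

lemma indet_in_poly_ring: "x \<in> A \<Longrightarrow> indet x \<in> carrier (poly_ring A)"
  by (simp add: carrier_poly_ring indet_def)

lemma poly_ring_idealI:
  fixes J :: "(('x \<Rightarrow>\<^sub>0 nat) \<Rightarrow>\<^sub>0 'k::comm_ring_1) set"
  assumes "J \<subseteq> carrier (poly_ring A)" "0 \<in> J"
    and add: "\<And>p q. p \<in> J \<Longrightarrow> q \<in> J \<Longrightarrow> p + q \<in> J"
    and mult: "\<And>p q. p \<in> carrier (poly_ring A) \<Longrightarrow> q \<in> J \<Longrightarrow> p * q \<in> J"
  shows "ideal J (poly_ring A)"
proof -
  interpret cring "poly_ring A :: (('x \<Rightarrow>\<^sub>0 nat) \<Rightarrow>\<^sub>0 'k) ring" by (rule cring_poly_ring)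
  have uminus: "- p \<in> J" if "p \<in> J" for p
    using mult[OF poly_ring_a_inv(1)[OF poly_ring_closed(2)] that] by simp
  show ?thesis
  proof (rule idealI)
    show "subgroup J (add_monoid (poly_ring A))"
    proof (rule add.subgroupI)
      show "\<ominus>\<^bsub>poly_ring A\<^esub> p \<in> J" if "p \<in> J" for p
        using that assms(1) uminus by (auto simp: poly_ring_a_inv(2))
    qed (use assms in auto)
    show "q \<otimes>\<^bsub>poly_ring A\<^esub> p \<in> J" if "q \<in> J" "p \<in> carrier (poly_ring A)" for p q
      using mult[OF that(2,1)] by (simp add: mult.commute)
  qed (use mult ring_axioms in auto)
qed

lemma poly_ring_idealD:
  fixes J :: "(('x \<Rightarrow>\<^sub>0 nat) \<Rightarrow>\<^sub>0 'k::comm_ring_1) set"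
  assumes "ideal J (poly_ring A)"
  shows "J \<subseteq> carrier (poly_ring A)" "0 \<in> J"
    "p \<in> J \<Longrightarrow> q \<in> J \<Longrightarrow> p + q \<in> J" "p \<in> J \<Longrightarrow> q \<in> J \<Longrightarrow> p - q \<in> J"
    "p \<in> carrier (poly_ring A) \<Longrightarrow> q \<in> J \<Longrightarrow> p * q \<in> J"
proof -
  interpret ideal J "poly_ring A" by (rule assms)
  show sub: "J \<subseteq> carrier (poly_ring A)" and "0 \<in> J"
    using a_subset additive_subgroup.zero_closed[OF additive_subgroup_axioms] by simp_all
  show add: "p + q \<in> J" if "p \<in> J" "q \<in> J" for p q
    using additive_subgroup.a_closed[OF additive_subgroup_axioms that] by simp
  show "p - q \<in> J" if "p \<in> J" "q \<in> J"
    using add[OF that(1) additive_subgroup.a_inv_closed[OF additive_subgroup_axioms that(2)]] sub that(2) by (auto simp: poly_ring_a_inv(2))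
  show "p * q \<in> J" if "p \<in> carrier (poly_ring A)" "q \<in> J"
    using I_l_closed[OF that(2,1)] by simp
qed

section \<open>Heights in polynomial rings\<close>

lemma poly_mapping_sum_monomials:
  "(\<Sum>m\<in>Poly_Mapping.keys p. Poly_Mapping.single m (Poly_Mapping.lookup p m)) = p"
proof (rule poly_mapping_eqI)
  fix k
  have "(\<Sum>m\<in>Poly_Mapping.keys p. Poly_Mapping.lookup p m when m = k) = Poly_Mapping.lookup p k"
    by (simp add: when_def in_keys_iff)
  then show "Poly_Mapping.lookup (\<Sum>m\<in>Poly_Mapping.keys p. Poly_Mapping.single m (Poly_Mapping.lookup p m)) k = Poly_Mapping.lookup p k"
    by (simp add: lookup_sum lookup_single)
qed

text \<open>
  The upper bound on heights rests on the fact that more polynomials than indeterminates are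
  algebraically dependent. This is proved by counting the monomials that can occur in products of
  the given polynomials, which needs a bound on the exponents only.
\<close>

definition exponents_le :: "nat \<Rightarrow> (('x \<Rightarrow>\<^sub>0 nat) \<Rightarrow>\<^sub>0 'k::zero) \<Rightarrow> bool" where
  "exponents_le b p \<longleftrightarrow> (\<forall>m\<in>Poly_Mapping.keys p. \<forall>x. Poly_Mapping.lookup m x \<le> b)"

lemma exponents_le_mono: "exponents_le b p \<Longrightarrow> b \<le> b' \<Longrightarrow> exponents_le b' p"
  unfolding exponents_le_def using le_trans by blast

lemma exponents_le_mult:
  assumes "exponents_le b p" "exponents_le b' q"
  shows "exponents_le (b + b') (p * q)"
  unfolding exponents_le_def
proof (intro ballI allI)
  fix m x assume "m \<in> Poly_Mapping.keys (p * q)"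
  then obtain m1 m2 where "m = m1 + m2" "m1 \<in> Poly_Mapping.keys p" "m2 \<in> Poly_Mapping.keys q"
    using keys_mult[of p q] by blast
  then show "Poly_Mapping.lookup m x \<le> b + b'"
    using assms by (simp add: exponents_le_def lookup_add add_mono)
qed

lemma exponents_le_one: "exponents_le 0 (1 :: ('x \<Rightarrow>\<^sub>0 nat) \<Rightarrow>\<^sub>0 'k::comm_ring_1)"
  by (simp add: exponents_le_def)

lemma exponents_le_power: "exponents_le b p \<Longrightarrow> exponents_le (k * b) (p ^ k)"
  for p :: "('x \<Rightarrow>\<^sub>0 nat) \<Rightarrow>\<^sub>0 'k::comm_ring_1"
  by (induction k) (auto intro: exponents_le_mult exponents_le_one)

lemma exponents_le_prod:
  fixes f :: "'i \<Rightarrow> ('x \<Rightarrow>\<^sub>0 nat) \<Rightarrow>\<^sub>0 'k::comm_ring_1"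
  shows "(\<And>i. i \<in> I \<Longrightarrow> exponents_le (b i) (f i)) \<Longrightarrow> exponents_le (sum b I) (prod f I)"
  by (induction I rule: infinite_finite_induct) (auto intro: exponents_le_mult exponents_le_one)

lemma exponents_le_exists: "\<exists>b. exponents_le b (p :: ('x \<Rightarrow>\<^sub>0 nat) \<Rightarrow>\<^sub>0 'k::zero)"
proof -
  have "\<exists>b. \<forall>x. Poly_Mapping.lookup m x \<le> b" for m :: "'x \<Rightarrow>\<^sub>0 nat"
  proof (intro exI allI)
    fix x show "Poly_Mapping.lookup m x \<le> (\<Sum>y\<in>Poly_Mapping.keys m. Poly_Mapping.lookup m y)"
      by (cases "x \<in> Poly_Mapping.keys m") (auto simp: in_keys_iff intro: member_le_sum)
  qed
  then obtain b :: "('x \<Rightarrow>\<^sub>0 nat) \<Rightarrow> nat" where b: "\<And>m x. Poly_Mapping.lookup m x \<le> b m" by metis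
  have "exponents_le (\<Sum>m\<in>Poly_Mapping.keys p. b m) p"
    unfolding exponents_le_def
  proof (intro ballI allI)
    fix m x assume "m \<in> Poly_Mapping.keys p"
    then have "b m \<le> (\<Sum>m\<in>Poly_Mapping.keys p. b m)" by (auto intro: member_le_sum)
    then show "Poly_Mapping.lookup m x \<le> (\<Sum>m\<in>Poly_Mapping.keys p. b m)" using b le_trans by blast
  qed
  then show ?thesis ..
qed

lemma bounded_monomials:
  assumes "finite A"
  shows "finite {m :: 'x \<Rightarrow>\<^sub>0 nat. Poly_Mapping.keys m \<subseteq> A \<and> (\<forall>x. Poly_Mapping.lookup m x \<le> b)}" (is "finite ?M")
    and "card {m :: 'x \<Rightarrow>\<^sub>0 nat. Poly_Mapping.keys m \<subseteq> A \<and> (\<forall>x. Poly_Mapping.lookup m x \<le> b)} \<le> (b + 1) ^ card A"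
proof -
  let ?r = "\<lambda>m. restrict (Poly_Mapping.lookup m) A"
  have inj: "inj_on ?r ?M"
  proof (rule inj_onI, rule poly_mapping_eqI)
    fix m m' x assume m: "m \<in> ?M" "m' \<in> ?M" and eq: "?r m = ?r m'"
    show "Poly_Mapping.lookup m x = Poly_Mapping.lookup m' x"
    proof (cases "x \<in> A")
      case True then show ?thesis using fun_cong[OF eq, of x] by simp
    next
      case False
      then have "x \<notin> Poly_Mapping.keys m" "x \<notin> Poly_Mapping.keys m'" using m by auto
      then show ?thesis by (simp add: in_keys_iff)
    qed
  qed
  have sub: "?r ` ?M \<subseteq> PiE A (\<lambda>_. {..b})" by auto
  have fin: "finite (PiE A (\<lambda>_. {..b}))" using assms by (simp add: finite_PiE)
  show "finite ?M" using finite_imageD[OF finite_subset[OF sub fin] inj] .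
  have "card ?M = card (?r ` ?M)" using inj by (simp add: card_image)
  also have "\<dots> \<le> card (PiE A (\<lambda>_. {..b}))" by (rule card_mono[OF fin sub])
  also have "\<dots> = (b + 1) ^ card A" using assms by (simp add: card_PiE)
  finally show "card ?M \<le> (b + 1) ^ card A" .
qed

lemma poly_ring_primeidealD:
  fixes P :: "(('x \<Rightarrow>\<^sub>0 nat) \<Rightarrow>\<^sub>0 'k::comm_ring_1) set"
  assumes "primeideal P (poly_ring A)"
  shows "ideal P (poly_ring A)" "1 \<notin> P"
    "p \<in> carrier (poly_ring A) \<Longrightarrow> q \<in> carrier (poly_ring A) \<Longrightarrow> p * q \<in> P \<Longrightarrow> p \<in> P \<or> q \<in> P"
proof -
  interpret primeideal P "poly_ring A" by (rule assms)
  show "ideal P (poly_ring A)" by (rule ideal_axioms)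
  show "1 \<notin> P" using one_imp_carrier I_notcarr by auto
  show "p \<in> carrier (poly_ring A) \<Longrightarrow> q \<in> carrier (poly_ring A) \<Longrightarrow> p * q \<in> P \<Longrightarrow> p \<in> P \<or> q \<in> P"
    using I_prime[of p q] by simp
qed

lemma poly_ring_prime_power:
  fixes P :: "(('x \<Rightarrow>\<^sub>0 nat) \<Rightarrow>\<^sub>0 'k::comm_ring_1) set"
  assumes "primeideal P (poly_ring A)" "p \<in> carrier (poly_ring A)" "p ^ k \<in> P"
  shows "p \<in> P"
  using assms(3)
proof (induction k)
  case 0 then show ?case using poly_ring_primeidealD(2)[OF assms(1)] by simp
next
  case (Suc k)
  then show ?case
    using poly_ring_primeidealD(3)[OF assms(1,2) poly_ring_power_closed[OF assms(2)], of k] by auto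
qed

text \<open>
  The monomials in the elements \<open>z i\<close> are given by exponent vectors \<open>m\<close> that are extensional on the
  index set, so that different elements of \<open>M\<close> are different monomials; as \<open>M\<close> is nonempty and all
  coefficients are nonzero, the relation is nontrivial.
\<close>

definition algebraically_dependent_mod ::
    "(('x \<Rightarrow>\<^sub>0 nat) \<Rightarrow>\<^sub>0 'k::field) set \<Rightarrow> 'i set \<Rightarrow> ('i \<Rightarrow> ('x \<Rightarrow>\<^sub>0 nat) \<Rightarrow>\<^sub>0 'k) \<Rightarrow> bool" where
  "algebraically_dependent_mod P I z \<longleftrightarrow>
     (\<exists>M c. finite M \<and> M \<noteq> {} \<and> M \<subseteq> PiE I (\<lambda>_. UNIV) \<and> (\<forall>m\<in>M. c m \<noteq> 0) \<and>
        (\<Sum>m\<in>M. Poly_Mapping.single 0 (c m) * (\<Prod>i\<in>I. z i ^ m i)) \<in> P)"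

lemma algebraically_dependent_modI:
  assumes "(\<Sum>m\<in>M. Poly_Mapping.single 0 (c m) * (\<Prod>i\<in>I. z i ^ m i)) \<in> P"
    and "finite M" "M \<noteq> {}" "M \<subseteq> PiE I (\<lambda>_. UNIV)" "\<And>m. m \<in> M \<Longrightarrow> c m \<noteq> 0"
  shows "algebraically_dependent_mod P I z"
  using assms unfolding algebraically_dependent_mod_def by blast

lemma algebraically_dependent_mod_mono:
  "algebraically_dependent_mod P I z \<Longrightarrow> P \<subseteq> Q \<Longrightarrow> algebraically_dependent_mod Q I z"
  unfolding algebraically_dependent_mod_def by blast

lemma vector_space_poly:
  "vector_space (\<lambda>(c::'k::field) (p :: ('x \<Rightarrow>\<^sub>0 nat) \<Rightarrow>\<^sub>0 'k). Poly_Mapping.single 0 c * p)"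
  by unfold_locales (simp_all add: algebra_simps single_add mult_single flip: mult.assoc)

text \<open>
  Among the products of powers \<open>z i ^ m i\<close> with all \<open>m i < D\<close> there are \<open>D ^ card I\<close>, while the
  monomials that occur in them number at most \<open>(D * B + 1) ^ card A\<close>, where \<open>B\<close> is independent of
  \<open>D\<close>. The first quantity grows faster with \<open>D\<close>, so for a suitable \<open>D\<close> the products are linearly
  dependent over the field.
\<close>

lemma poly_dependent_if_card_gt:
  fixes z :: "'i \<Rightarrow> ('x \<Rightarrow>\<^sub>0 nat) \<Rightarrow>\<^sub>0 'k::field"
  assumes fin: "finite A" "finite I" and z: "\<And>i. i \<in> I \<Longrightarrow> z i \<in> carrier (poly_ring A)"
    and card: "card A < card I"
  shows "algebraically_dependent_mod {0} I z"
proof -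
  interpret vs: vector_space "\<lambda>(c::'k) (p :: ('x \<Rightarrow>\<^sub>0 nat) \<Rightarrow>\<^sub>0 'k). Poly_Mapping.single 0 c * p"
    by (rule vector_space_poly)
  have "\<exists>b. \<forall>i. exponents_le (b i) (z i)" by (intro choice allI exponents_le_exists)
  then obtain b where b: "\<And>i. exponents_le (b i) (z i)" by blast
  define B where "B = sum b I"
  \<comment> \<open>so that \<open>D ^ a * (B + 1) ^ a < D ^ (a + 1)\<close> for \<open>a = card A\<close>\<close>
  define D where "D = (B + 1) ^ card A + 1"
  define E where "E = PiE I (\<lambda>_. {..<D})"
  define F where "F m = (\<Prod>i\<in>I. z i ^ m i)" for m
  have E_UNIV: "E \<subseteq> PiE I (\<lambda>_. UNIV)" by (auto simp: E_def PiE_iff)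
  have finE: "finite E" unfolding E_def using fin(2) by (simp add: finite_PiE)
  have cardE: "card E = D ^ card I" unfolding E_def using fin(2) by (simp add: card_PiE)
  define T where "T = (\<lambda>t. Poly_Mapping.single t (1::'k)) `
    {t :: 'x \<Rightarrow>\<^sub>0 nat. Poly_Mapping.keys t \<subseteq> A \<and> (\<forall>x. Poly_Mapping.lookup t x \<le> D * B)}"
  have finT: "finite T" unfolding T_def using bounded_monomials(1)[OF fin(1)] by simp
  have "card T \<le> (D * B + 1) ^ card A"
    unfolding T_def using card_image_le[OF bounded_monomials(1)[OF fin(1)]]
      bounded_monomials(2)[OF fin(1)] le_trans by blast
  also have "\<dots> \<le> (D * (B + 1)) ^ card A" by (rule power_mono) (auto simp: D_def)
  also have "\<dots> = D ^ card A * (B + 1) ^ card A" by (rule power_mult_distrib)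
  also have "\<dots> < D ^ card A * D" by (simp add: D_def)
  also have "\<dots> = D ^ Suc (card A)" by simp
  also have "\<dots> \<le> D ^ card I" using card by (intro power_increasing) (auto simp: D_def)
  finally have few: "card T < card E" using cardE by simp
  have span: "F m \<in> vs.span T" if m: "m \<in> E" for m
  proof -
    have carr: "F m \<in> carrier (poly_ring A)"
      unfolding F_def by (intro poly_ring_prod_closed poly_ring_power_closed z)
    have "exponents_le (\<Sum>i\<in>I. m i * b i) (F m)"
      unfolding F_def by (intro exponents_le_prod exponents_le_power b)
    moreover have "(\<Sum>i\<in>I. m i * b i) \<le> (\<Sum>i\<in>I. D * b i)"
      using m by (intro sum_mono mult_right_mono) (auto simp: E_def PiE_iff intro: less_imp_le)
    ultimately have ex: "exponents_le (D * B) (F m)"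
      by (auto intro: exponents_le_mono simp: B_def sum_distrib_left)
    have "(\<Sum>t\<in>Poly_Mapping.keys (F m). Poly_Mapping.single 0 (Poly_Mapping.lookup (F m) t) *
        Poly_Mapping.single t 1) \<in> vs.span T"
    proof (intro vs.span_sum vs.span_scale vs.span_base)
      fix t assume "t \<in> Poly_Mapping.keys (F m)"
      then show "Poly_Mapping.single t 1 \<in> T"
        using carr ex unfolding T_def carrier_poly_ring exponents_le_def by blast
    qed
    then show ?thesis by (simp add: mult_single poly_mapping_sum_monomials)
  qed
  show ?thesis
  proof (cases "inj_on F E")
    case True
    have "vs.dependent (F ` E)"
    proof (rule ccontr)
      assume "vs.independent (F ` E)"
      then have "card (F ` E) \<le> card T"
        using vs.independent_span_bound[OF finT] span by (meson image_subsetI)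
      then show False using few True by (simp add: card_image)
    qed
    then obtain u where u: "\<exists>v\<in>F ` E. u v \<noteq> 0"
      and "(\<Sum>v\<in>F ` E. Poly_Mapping.single 0 (u v) * v) = 0"
      using vs.dependent_finite[of "F ` E"] finE by auto
    then have 0: "(\<Sum>m\<in>E. Poly_Mapping.single 0 (u (F m)) * F m) = 0"
      using True by (simp add: sum.reindex)
    have "(\<Sum>m\<in>{m\<in>E. u (F m) \<noteq> 0}. Poly_Mapping.single 0 (u (F m)) * F m) = 0"
      using finE by (subst 0[symmetric], intro sum.mono_neutral_left) auto
    then have "(\<Sum>m\<in>{m\<in>E. u (F m) \<noteq> 0}. Poly_Mapping.single 0 (u (F m)) * (\<Prod>i\<in>I. z i ^ m i)) \<in> {0}"
      unfolding F_def by simp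
    then show ?thesis
      by (rule algebraically_dependent_modI) (use u finE E_UNIV in auto)
  next
    case False
    then obtain m m' where mm: "m \<in> E" "m' \<in> E" "m \<noteq> m'" "F m = F m'"
      by (auto simp: inj_on_def)
    then have "(\<Sum>x\<in>{m, m'}. Poly_Mapping.single 0 (if x = m then 1 else - 1) * (\<Prod>i\<in>I. z i ^ x i)) \<in> {0}"
      by (simp add: F_def single_uminus)
    then show ?thesis
      by (rule algebraically_dependent_modI) (use mm E_UNIV in auto)
  qed
qed

text \<open>
  Dividing a relation by the largest possible power of \<open>z k\<close> keeps it inside the prime \<open>P\<close>, because
  \<open>z k \<notin> P\<close>; after that, the terms still divisible by \<open>z k\<close> lie in \<open>Q\<close> and can be dropped. What
  remains is a nontrivial relation modulo \<open>Q\<close> without \<open>z k\<close>.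
\<close>

lemma algebraically_dependent_mod_eliminate:
  fixes z :: "'i \<Rightarrow> ('x \<Rightarrow>\<^sub>0 nat) \<Rightarrow>\<^sub>0 'k::field"
  assumes dep: "algebraically_dependent_mod P (insert k I) z"
    and I: "finite I" "k \<notin> I" and z: "\<And>i. i \<in> insert k I \<Longrightarrow> z i \<in> carrier (poly_ring A)"
    and P: "primeideal P (poly_ring A)" "z k \<notin> P"
    and Q: "ideal Q (poly_ring A)" "P \<subseteq> Q" "z k \<in> Q"
  shows "algebraically_dependent_mod Q I z"
proof -
  let ?C = "Poly_Mapping.single 0 :: 'k \<Rightarrow> ('x \<Rightarrow>\<^sub>0 nat) \<Rightarrow>\<^sub>0 'k"
  obtain M c where M: "finite M" "M \<noteq> {}" "M \<subseteq> PiE (insert k I) (\<lambda>_. UNIV)"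
    and c: "\<And>m. m \<in> M \<Longrightarrow> c m \<noteq> 0"
    and sum: "(\<Sum>m\<in>M. ?C (c m) * (\<Prod>i\<in>insert k I. z i ^ m i)) \<in> P"
    using dep unfolding algebraically_dependent_mod_def by blast
  define R where "R m = ?C (c m) * (\<Prod>i\<in>I. z i ^ m i)" for m
  have R: "R m \<in> carrier (poly_ring A)" for m
    unfolding R_def
    by (intro poly_ring_closed poly_ring_prod_closed poly_ring_power_closed const_in_poly_ring z) simp
  \<comment> \<open>the exponent of the power of \<open>z k\<close> that divides the whole relation\<close>
  define \<mu> where "\<mu> = Min ((\<lambda>m. m k) ` M)"
  define M1 where "M1 = {m\<in>M. m k = \<mu>}"
  have "\<mu> \<in> (\<lambda>m. m k) ` M" unfolding \<mu>_def using M by (intro Min_in) auto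
  then have M1: "finite M1" "M1 \<noteq> {}" "M1 \<subseteq> M" using M by (auto simp: M1_def)
  have \<mu>: "\<mu> < m k" if "m \<in> M - M1" for m
  proof -
    have "\<mu> \<le> m k" unfolding \<mu>_def using M(1) that by (intro Min_le) auto
    then show ?thesis using that by (auto simp: M1_def)
  qed
  define p where "p = (\<Sum>m\<in>M1. R m)"
  define q where "q = (\<Sum>m\<in>M - M1. z k ^ (m k - \<mu> - 1) * R m)"
  have pq: "p \<in> carrier (poly_ring A)" "q \<in> carrier (poly_ring A)"
    unfolding p_def q_def
    by (intro poly_ring_sum_closed poly_ring_closed poly_ring_power_closed R z insertI1)+
  have "(\<Sum>m\<in>M. ?C (c m) * (\<Prod>i\<in>insert k I. z i ^ m i)) = (\<Sum>m\<in>M. z k ^ m k * R m)"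
    using I by (simp add: R_def mult_ac)
  also have "\<dots> = (\<Sum>m\<in>M1. z k ^ m k * R m) + (\<Sum>m\<in>M - M1. z k ^ m k * R m)"
    using M(1) M1(3) by (simp add: sum.subset_diff add.commute)
  also have "(\<Sum>m\<in>M1. z k ^ m k * R m) = z k ^ \<mu> * p"
    by (simp add: p_def sum_distrib_left M1_def)
  also have "(\<Sum>m\<in>M - M1. z k ^ m k * R m) = z k ^ \<mu> * (z k * q)"
    unfolding q_def sum_distrib_left
  proof (rule sum.cong[OF refl])
    fix m assume "m \<in> M - M1"
    from \<mu>[OF this] have "z k ^ m k = z k ^ \<mu> * (z k * z k ^ (m k - \<mu> - 1))"
      by (simp flip: power_Suc power_add)
    then show "z k ^ m k * R m = z k ^ \<mu> * (z k * (z k ^ (m k - \<mu> - 1) * R m))"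
      by (simp only: mult.assoc)
  qed
  finally have "z k ^ \<mu> * (p + z k * q) \<in> P" using sum by (simp add: distrib_left)
  then have "p + z k * q \<in> P"
    using poly_ring_primeidealD(3)[OF P(1)] poly_ring_prime_power[OF P(1)] P(2) pq z
    by (metis poly_ring_closed(3,4) poly_ring_power_closed insertI1)
  moreover have "q * z k \<in> Q" by (intro poly_ring_idealD(5)[OF Q(1)] pq Q)
  ultimately have "(p + z k * q) - q * z k \<in> Q"
    using Q by (intro poly_ring_idealD(4)[OF Q(1)]) auto
  then have p: "p \<in> Q" by (simp add: mult.commute)
  have restr: "(restrict m I)(k := \<mu>) = m" if "m \<in> M1" for m
    using that M(3) by (fastforce simp: M1_def PiE_iff extensional_def)
  have inj: "inj_on (\<lambda>m. restrict m I) M1"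
    by (rule inj_on_inverseI[where g = "\<lambda>m. m(k := \<mu>)"]) (rule restr)
  have "p = (\<Sum>m\<in>(\<lambda>m. restrict m I) ` M1. ?C (c (m(k := \<mu>))) * (\<Prod>i\<in>I. z i ^ m i))"
    unfolding p_def sum.reindex[OF inj] by (intro sum.cong) (auto simp: restr R_def)
  then show ?thesis
    unfolding algebraically_dependent_mod_def using p M1 c
    by (intro exI[of _ "(\<lambda>m. restrict m I) ` M1"] exI[of _ "\<lambda>m. c (m(k := \<mu>))"])
      (auto simp: restr)
qed

text \<open>
  Choose \<open>z i \<in> c (i + 1) - c i\<close> along a chain of primes \<open>c 0 \<subset> \<dots> \<subset> c n = P\<close>. If \<open>n + card U\<close> exceeded
  the number of indeterminates, the elements \<open>z i\<close> together with the indeterminates in \<open>U\<close> would be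
  algebraically dependent. Going up the chain eliminates \<open>z 0\<close>, \<open>z 1\<close>, and so on from the relation; what
  is left at the top is a nonzero polynomial in \<open>U\<close> that lies in \<open>P\<close>.
\<close>

theorem height_le_if_indets_independent:
  fixes P :: "(('x \<Rightarrow>\<^sub>0 nat) \<Rightarrow>\<^sub>0 'k::field) set"
  assumes fin: "finite A" and U: "U \<subseteq> A"
    and indep: "\<And>p. p \<in> carrier (poly_ring U) \<Longrightarrow> p \<in> P \<Longrightarrow> p = 0"
  shows "height (poly_ring A) P \<le> enat (card A - card U)"
  unfolding height_def
proof (rule Sup_least)
  fix h assume "h \<in> {enat n |n. \<exists>c :: nat \<Rightarrow> (('x \<Rightarrow>\<^sub>0 nat) \<Rightarrow>\<^sub>0 'k) set.
     (\<forall>i\<le>n. primeideal (c i) (poly_ring A)) \<and> (\<forall>i<n. c i \<subset> c (Suc i)) \<and> c n = P}"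
  then obtain n c where h: "h = enat n" and prime: "\<And>i. i \<le> n \<Longrightarrow> primeideal (c i) (poly_ring A)"
    and strict: "\<And>i. i < n \<Longrightarrow> c i \<subset> c (Suc i)" and cn: "c n = P"
    by blast
  have finU: "finite U" using finite_subset[OF U fin] .
  have "\<exists>z. \<forall>i<n. z i \<in> c (Suc i) - c i" using strict by (intro choice) blast
  then obtain z where z: "\<And>i. i < n \<Longrightarrow> z i \<in> c (Suc i) - c i" by blast
  have zc: "z i \<in> carrier (poly_ring A)" if "i < n" for i
    using z[OF that] poly_ring_idealD(1)[OF poly_ring_primeidealD(1)[OF prime[of "Suc i"]]] that
    by auto
  define w where "w = case_sum z (indet :: 'x \<Rightarrow> ('x \<Rightarrow>\<^sub>0 nat) \<Rightarrow>\<^sub>0 'k)"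
  let ?I = "\<lambda>j. Inl ` {j..<n} \<union> Inr ` U"
  have wc: "w i \<in> carrier (poly_ring A)" if "i \<in> ?I j" for i j
    using that U zc by (auto simp: w_def intro!: indet_in_poly_ring)
  have "n \<le> card A - card U"
  proof (rule ccontr)
    assume "\<not> n \<le> card A - card U"
    then have "card A < card (?I 0)"
      using finU card_mono[OF fin U]
      by (subst card_Un_disjoint) (auto simp: card_image)
    then have "algebraically_dependent_mod {0} (?I 0) w"
      using fin finU wc by (intro poly_dependent_if_card_gt) auto
    then have base: "algebraically_dependent_mod (c 0) (?I 0) w"
      using poly_ring_idealD(2)[OF poly_ring_primeidealD(1)[OF prime[of 0]]]
      by (elim algebraically_dependent_mod_mono) simp
    \<comment> \<open>modulo \<open>c j\<close>, the elements \<open>z 0, \<dots>, z (j - 1)\<close> have been eliminated\<close>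
    have "algebraically_dependent_mod (c j) (?I j) w" if "j \<le> n" for j
      using that
    proof (induction j)
      case 0 then show ?case using base by simp
    next
      case (Suc j)
      have *: "?I j = insert (Inl j) (?I (Suc j))" using Suc.prems
        by (auto simp: image_iff)
      show ?case
      proof (rule algebraically_dependent_mod_eliminate)
        show "algebraically_dependent_mod (c j) (insert (Inl j) (?I (Suc j))) w"
          using Suc by (simp flip: *)
        show "w i \<in> carrier (poly_ring A)" if "i \<in> insert (Inl j) (?I (Suc j))" for i
          using wc[of i j] that by (simp only: *)
        show "w (Inl j) \<notin> c j" "w (Inl j) \<in> c (Suc j)" "c j \<subseteq> c (Suc j)"
          using z[of j] strict[of j] Suc.prems by (auto simp: w_def)
        show "primeideal (c j) (poly_ring A)" "ideal (c (Suc j)) (poly_ring A)"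
          using prime poly_ring_primeidealD(1) Suc.prems by auto
      qed (use finU in auto)
    qed
    from this[of n] have "algebraically_dependent_mod P (Inr ` U) w" using cn by simp
    then obtain M a where M: "finite M" "M \<noteq> {}" "M \<subseteq> PiE (Inr ` U) (\<lambda>_. UNIV)"
      and a: "\<And>m. m \<in> M \<Longrightarrow> a m \<noteq> 0"
      and sum: "(\<Sum>m\<in>M. Poly_Mapping.single 0 (a m) * (\<Prod>i\<in>Inr ` U. w i ^ m i)) \<in> P"
      unfolding algebraically_dependent_mod_def by blast
    define e where "e m = (\<Sum>u\<in>U. Poly_Mapping.single u (m (Inr u)))" for m :: "nat + 'x \<Rightarrow> nat"
    have power: "indet x ^ k = Poly_Mapping.single (Poly_Mapping.single x k) (1::'k)" for x :: 'x and k
      by (induction k) (simp_all add: indet_def mult_single flip: single_add)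
    have prod_single: "(\<Prod>u\<in>V. Poly_Mapping.single (f u) (1::'k)) = Poly_Mapping.single (\<Sum>u\<in>V. f u) 1"
      for V and f :: "'x \<Rightarrow> 'x \<Rightarrow>\<^sub>0 nat"
      by (induction V rule: infinite_finite_induct) (simp_all add: mult_single)
    have eq: "(\<Sum>m\<in>M. Poly_Mapping.single 0 (a m) * (\<Prod>i\<in>Inr ` U. w i ^ m i)) =
      (\<Sum>m\<in>M. Poly_Mapping.single (e m) (a m))" (is "_ = ?p")
      by (simp add: prod.reindex w_def power prod_single mult_single e_def)
    have look: "Poly_Mapping.lookup (e m) u = m (Inr u)" if "u \<in> U" for m u
      using that finU by (simp add: e_def lookup_sum lookup_single when_def)
    have inj: "inj_on e M"
    proof (rule inj_onI)
      fix m m' assume m: "m \<in> M" "m' \<in> M" and eq: "e m = e m'"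
      have "m (Inr u) = m' (Inr u)" if "u \<in> U" for u
        using look[OF that, of m] look[OF that, of m'] eq by simp
      then show "m = m'" using M(3) m by (intro PiE_ext[of m "Inr ` U" _ m']) auto
    qed
    obtain m where m: "m \<in> M" using M(2) by blast
    have "Poly_Mapping.lookup ?p (e m) = (\<Sum>m'\<in>M. if m' = m then a m' else 0)"
      unfolding lookup_sum lookup_single when_def
      using inj m by (intro sum.cong) (auto simp: inj_on_def)
    then have "?p \<noteq> 0" using m M(1) a by auto
    moreover have "?p \<in> carrier (poly_ring U)"
    proof (intro poly_ring_sum_closed single_in_poly_ring)
      show "Poly_Mapping.keys (e m) \<subseteq> U" for m
        unfolding e_def using keys_sum[of "\<lambda>u. Poly_Mapping.single u (m (Inr u))" U]
        by (auto split: if_splits)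
    qed
    ultimately show False using indep sum eq by metis
  qed
  then show "h \<le> enat (card A - card U)" by (simp add: h)
qed

section \<open>Monomial maps\<close>

definition monomial_map ::
    "(('x \<Rightarrow>\<^sub>0 nat) \<Rightarrow> 'e \<Rightarrow>\<^sub>0 'k) \<Rightarrow> (('x \<Rightarrow>\<^sub>0 nat) \<Rightarrow>\<^sub>0 'k) \<Rightarrow> 'e::comm_monoid_add \<Rightarrow>\<^sub>0 'k::comm_ring_1" where
  "monomial_map w p = (\<Sum>m\<in>Poly_Mapping.keys p. Poly_Mapping.single 0 (Poly_Mapping.lookup p m) * w m)"

lemma monomial_map_add: "monomial_map w (p + q) = monomial_map w p + monomial_map w q"
  unfolding monomial_map_def
  by (rule setsum_keys_plus_distrib[of "\<lambda>m c. Poly_Mapping.single 0 c * w m"])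
    (simp_all add: single_add algebra_simps)

lemma monomial_map_zero [simp]: "monomial_map w 0 = 0"
  by (simp add: monomial_map_def)

lemma monomial_map_diff: "monomial_map w (p - q) = monomial_map w p - monomial_map w q"
  using monomial_map_add[of w "p - q" q] by (simp add: algebra_simps)

lemma monomial_map_sum: "monomial_map w (sum f I) = (\<Sum>i\<in>I. monomial_map w (f i))"
  by (induction I rule: infinite_finite_induct) (simp_all add: monomial_map_add)

lemma monomial_map_single: "monomial_map w (Poly_Mapping.single m c) = Poly_Mapping.single 0 c * w m"
  by (simp add: monomial_map_def)

lemma monomial_map_mult:
  fixes w :: "('x \<Rightarrow>\<^sub>0 nat) \<Rightarrow> 'e::comm_monoid_add \<Rightarrow>\<^sub>0 'k::comm_ring_1"
  assumes "\<And>m m'. w (m + m') = w m * w m'"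
  shows "monomial_map w (p * q) = monomial_map w p * monomial_map w q"
proof -
  have "monomial_map w (p * q) =
    monomial_map w ((\<Sum>m\<in>Poly_Mapping.keys p. Poly_Mapping.single m (Poly_Mapping.lookup p m)) *
      (\<Sum>m\<in>Poly_Mapping.keys q. Poly_Mapping.single m (Poly_Mapping.lookup q m)))"
    by (simp only: poly_mapping_sum_monomials)
  also have "\<dots> = (\<Sum>m\<in>Poly_Mapping.keys p. \<Sum>m'\<in>Poly_Mapping.keys q.
      Poly_Mapping.single 0 (Poly_Mapping.lookup p m * Poly_Mapping.lookup q m') * (w m * w m'))"
    by (simp add: sum_product monomial_map_sum mult_single monomial_map_single assms)
  also have "\<dots> = (\<Sum>m\<in>Poly_Mapping.keys p. \<Sum>m'\<in>Poly_Mapping.keys q.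
      (Poly_Mapping.single 0 (Poly_Mapping.lookup p m) * w m) *
      (Poly_Mapping.single 0 (Poly_Mapping.lookup q m') * w m'))"
  proof (intro sum.cong refl)
    fix m m'
    have "Poly_Mapping.single (0::'e) (Poly_Mapping.lookup p m * Poly_Mapping.lookup q m') =
      Poly_Mapping.single 0 (Poly_Mapping.lookup p m) * Poly_Mapping.single 0 (Poly_Mapping.lookup q m')"
      by (simp add: mult_single)
    then show "Poly_Mapping.single 0 (Poly_Mapping.lookup p m * Poly_Mapping.lookup q m') * (w m * w m') =
      (Poly_Mapping.single 0 (Poly_Mapping.lookup p m) * w m) *
      (Poly_Mapping.single 0 (Poly_Mapping.lookup q m') * w m')"
      by (simp only: mult_ac)
  qed
  also have "\<dots> = monomial_map w p * monomial_map w q"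
    by (simp add: monomial_map_def sum_product)
  finally show ?thesis .
qed

section \<open>The toric primes of a partitioned vertex set\<close>

abbreviation edge_vars :: "'v set \<Rightarrow> 'v edge_var set" where
  "edge_vars V \<equiv> XVar ` V \<union> YVar ` V"

text \<open>
  For a set \<open>S\<close> of vertices and a function \<open>\<rho>\<close> that names the class of each vertex, consider the
  homomorphism with \<open>x\<^sub>i \<mapsto> a\<^sub>i\<close> and \<open>y\<^sub>i \<mapsto> a\<^sub>i t\<^bsub>\<rho> i\<^esub>\<close> for \<open>i \<notin> S\<close>, and \<open>x\<^sub>i, y\<^sub>i \<mapsto> 0\<close> for \<open>i \<in> S\<close>. The
  indeterminates of its target are the pairs \<open>(False, i)\<close>, for \<open>a\<^sub>i\<close>, and \<open>(True, c)\<close>, for \<open>t\<^sub>c\<close>; the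
  lexicographic order on these pairs yields leading terms, by which the target is an integral domain. The
  kernel of the homomorphism is the prime ideal
  generated by the variables of \<open>S\<close> and the \<open>2 \<times> 2\<close> minors within each class, the familiar shape of
  the minimal primes of binomial edge ideals. The kernel is taken as the definition since it makes
  primality evident; that the generators suffice is shown below.
\<close>

fun toric_weight :: "('v \<Rightarrow> 'v) \<Rightarrow> 'v edge_var \<Rightarrow> nat \<Rightarrow> bool \<times> 'v \<Rightarrow>\<^sub>0 nat" where
  "toric_weight \<rho> (XVar i) n = Poly_Mapping.single (False, i) n"
| "toric_weight \<rho> (YVar i) n = Poly_Mapping.single (False, i) n + Poly_Mapping.single (True, \<rho> i) n"

definition toric_exponent :: "('v \<Rightarrow> 'v) \<Rightarrow> ('v edge_var \<Rightarrow>\<^sub>0 nat) \<Rightarrow> bool \<times> 'v \<Rightarrow>\<^sub>0 nat" where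
  "toric_exponent \<rho> m = (\<Sum>x\<in>Poly_Mapping.keys m. toric_weight \<rho> x (Poly_Mapping.lookup m x))"

definition toric_monomial ::
    "'v set \<Rightarrow> ('v \<Rightarrow> 'v) \<Rightarrow> ('v edge_var \<Rightarrow>\<^sub>0 nat) \<Rightarrow> (bool \<times> 'v \<Rightarrow>\<^sub>0 nat) \<Rightarrow>\<^sub>0 'k::field" where
  "toric_monomial S \<rho> m =
     (if Poly_Mapping.keys m \<inter> edge_vars S = {} then Poly_Mapping.single (toric_exponent \<rho> m) 1 else 0)"

definition toric_kernel ::
    "'v set \<Rightarrow> 'v set \<Rightarrow> ('v \<Rightarrow> 'v) \<Rightarrow> (('v edge_var \<Rightarrow>\<^sub>0 nat) \<Rightarrow>\<^sub>0 'k::field) set" where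
  "toric_kernel V S \<rho> =
     {p \<in> carrier (poly_ring (edge_vars V)). monomial_map (toric_monomial S \<rho>) p = 0}"

definition edge_binomial :: "'v \<Rightarrow> 'v \<Rightarrow> ('v edge_var \<Rightarrow>\<^sub>0 nat) \<Rightarrow>\<^sub>0 'k::comm_ring_1" where
  "edge_binomial i j = indet (XVar i) * indet (YVar j) - indet (XVar j) * indet (YVar i)"

lemma toric_exponent_add: "toric_exponent \<rho> (m + m') = toric_exponent \<rho> m + toric_exponent \<rho> m'"
proof -
  have 0: "toric_weight \<rho> x 0 = 0" for x by (cases x) simp_all
  have plus: "toric_weight \<rho> x (a + b) = toric_weight \<rho> x a + toric_weight \<rho> x b" for x a b
    by (cases x) (simp_all add: single_add add_ac)
  show ?thesis
    unfolding toric_exponent_def by (rule setsum_keys_plus_distrib[of "toric_weight \<rho>", OF 0 plus])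
qed

lemma toric_exponent_single: "toric_exponent \<rho> (Poly_Mapping.single x n) = toric_weight \<rho> x n"
  by (cases x) (simp_all add: toric_exponent_def)

lemma toric_exponent_zero [simp]: "toric_exponent \<rho> 0 = 0"
  by (simp add: toric_exponent_def)

lemma keys_add_nat:
  "Poly_Mapping.keys (m + m' :: 'x \<Rightarrow>\<^sub>0 nat) = Poly_Mapping.keys m \<union> Poly_Mapping.keys m'"
  by (auto simp: in_keys_iff lookup_add)

lemma toric_monomial_add: "toric_monomial S \<rho> (m + m') = toric_monomial S \<rho> m * toric_monomial S \<rho> m'"
  by (auto simp: toric_monomial_def keys_add_nat toric_exponent_add mult_single)

lemmas toric_map_mult = monomial_map_mult[of "toric_monomial S \<rho>" for S \<rho>, OF toric_monomial_add]

lemma toric_map_one: "monomial_map (toric_monomial S \<rho>) 1 = 1"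
  using monomial_map_single[of "toric_monomial S \<rho>" 0 1] by (simp add: toric_monomial_def)

lemma lookup_toric_exponent_vertex:
  "Poly_Mapping.lookup (toric_exponent \<rho> m) (False, i) =
   Poly_Mapping.lookup m (XVar i) + Poly_Mapping.lookup m (YVar i)"
proof -
  have "Poly_Mapping.lookup (toric_weight \<rho> x n) (False, i) =
    (if x = XVar i then n else 0) + (if x = YVar i then n else 0)" for x n
    by (cases x) (auto simp: lookup_single lookup_add when_def)
  then show ?thesis
    by (simp add: toric_exponent_def lookup_sum sum.distrib in_keys_iff)
qed

lemma lookup_toric_exponent_class:
  "Poly_Mapping.lookup (toric_exponent \<rho> m) (True, c) =
   (\<Sum>i | YVar i \<in> Poly_Mapping.keys m \<and> \<rho> i = c. Poly_Mapping.lookup m (YVar i))"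
proof -
  have "Poly_Mapping.lookup (toric_exponent \<rho> m) (True, c) =
    (\<Sum>x\<in>Poly_Mapping.keys m. Poly_Mapping.lookup (toric_weight \<rho> x (Poly_Mapping.lookup m x)) (True, c))"
    by (simp add: toric_exponent_def lookup_sum)
  also have "\<dots> = (\<Sum>x\<in>YVar ` {i. YVar i \<in> Poly_Mapping.keys m \<and> \<rho> i = c}. Poly_Mapping.lookup m x)"
  proof (rule sum.mono_neutral_cong_right; (intro ballI)?)
    fix x assume "x \<in> Poly_Mapping.keys m - YVar ` {i. YVar i \<in> Poly_Mapping.keys m \<and> \<rho> i = c}"
    then show "Poly_Mapping.lookup (toric_weight \<rho> x (Poly_Mapping.lookup m x)) (True, c) = 0"
      by (cases x) (auto simp: lookup_add lookup_single when_def)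
  qed (auto simp: lookup_add lookup_single)
  also have "\<dots> = (\<Sum>i | YVar i \<in> Poly_Mapping.keys m \<and> \<rho> i = c. Poly_Mapping.lookup m (YVar i))"
    by (simp add: sum.reindex inj_on_def)
  finally show ?thesis .
qed

lemma finite_YVar_keys: "finite {i. YVar i \<in> Poly_Mapping.keys m \<and> Q i}"
  using finite_subset[OF _ finite_vimageI[OF finite_keys[of m], of YVar], of "{i. YVar i \<in> Poly_Mapping.keys m \<and> Q i}"]
  by (simp add: inj_def subset_eq)

lemma toric_exponent_class_pos:
  "Poly_Mapping.lookup (toric_exponent \<rho> m) (True, c) \<noteq> 0 \<longleftrightarrow>
   (\<exists>i. YVar i \<in> Poly_Mapping.keys m \<and> \<rho> i = c)"
  using finite_YVar_keys[of m "\<lambda>i. \<rho> i = c"]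
  by (auto simp: lookup_toric_exponent_class in_keys_iff)

lemma lookup_toric_map:
  assumes "\<And>m. m \<in> Poly_Mapping.keys p \<Longrightarrow> Poly_Mapping.keys m \<inter> edge_vars S = {}"
  shows "Poly_Mapping.lookup (monomial_map (toric_monomial S \<rho>) p) e =
    (\<Sum>m | m \<in> Poly_Mapping.keys p \<and> toric_exponent \<rho> m = e. Poly_Mapping.lookup p m)"
proof -
  have "Poly_Mapping.lookup (monomial_map (toric_monomial S \<rho>) p) e =
    (\<Sum>m\<in>Poly_Mapping.keys p. Poly_Mapping.lookup p m when toric_exponent \<rho> m = e)"
    unfolding monomial_map_def lookup_sum
    using assms by (intro sum.cong) (auto simp: toric_monomial_def mult_single lookup_single)
  also have "\<dots> = (\<Sum>m | m \<in> Poly_Mapping.keys p \<and> toric_exponent \<rho> m = e. Poly_Mapping.lookup p m)"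
    by (simp add: when_def sum.inter_filter)
  finally show ?thesis .
qed

lemma toric_map_indet:
  "monomial_map (toric_monomial S \<rho>) (indet x) =
   (if x \<in> edge_vars S then 0 else Poly_Mapping.single (toric_weight \<rho> x 1) 1)"
  by (simp add: indet_def monomial_map_single toric_monomial_def toric_exponent_single)

lemma toric_map_edge_binomial_eq_0_iff:
  "monomial_map (toric_monomial S \<rho>) (edge_binomial i j) = 0 \<longleftrightarrow> i \<in> S \<or> j \<in> S \<or> \<rho> i = \<rho> j"
proof (cases "i \<in> S \<or> j \<in> S")
  case True then show ?thesis
    by (auto simp: edge_binomial_def monomial_map_diff toric_map_mult toric_map_indet)
next
  case False
  then have "monomial_map (toric_monomial S \<rho>) (edge_binomial i j) =
    (Poly_Mapping.single (toric_weight \<rho> (XVar i) 1 + toric_weight \<rho> (YVar j) 1) 1 -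
     Poly_Mapping.single (toric_weight \<rho> (XVar j) 1 + toric_weight \<rho> (YVar i) 1) 1
       :: (bool \<times> 'a \<Rightarrow>\<^sub>0 nat) \<Rightarrow>\<^sub>0 'b)"
    by (auto simp: edge_binomial_def monomial_map_diff toric_map_mult toric_map_indet mult_single)
  moreover have "toric_weight \<rho> (XVar i) 1 + toric_weight \<rho> (YVar j) 1 =
      toric_weight \<rho> (XVar j) 1 + toric_weight \<rho> (YVar i) 1 \<longleftrightarrow>
    Poly_Mapping.single (True, \<rho> j) (1::nat) = Poly_Mapping.single (True, \<rho> i) 1"
    by (simp add: add_ac)
  moreover have "Poly_Mapping.single a (1::nat) = Poly_Mapping.single b 1 \<longleftrightarrow> a = b" for a b :: "bool \<times> 'a"
    by (metis lookup_single_eq lookup_single_not_eq zero_neq_one)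
  moreover have "Poly_Mapping.single a (1::'b) = Poly_Mapping.single b 1 \<longleftrightarrow> a = b"
    for a b :: "bool \<times> 'a \<Rightarrow>\<^sub>0 nat"
    by (metis lookup_single_eq lookup_single_not_eq zero_neq_one)
  ultimately show ?thesis using False by auto
qed

lemma edge_binomial_in_poly_ring:
  "i \<in> V \<Longrightarrow> j \<in> V \<Longrightarrow> edge_binomial i j \<in> carrier (poly_ring (edge_vars V))"
  unfolding edge_binomial_def by (intro poly_ring_closed indet_in_poly_ring) auto

lemma primeideal_toric_kernel:
  fixes V S :: "'v::linorder set"
  shows "primeideal (toric_kernel V S \<rho> :: (('v edge_var \<Rightarrow>\<^sub>0 nat) \<Rightarrow>\<^sub>0 'k::field) set)
    (poly_ring (edge_vars V))"
proof (rule primeidealI)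
  show "ideal (toric_kernel V S \<rho> :: (('v edge_var \<Rightarrow>\<^sub>0 nat) \<Rightarrow>\<^sub>0 'k) set) (poly_ring (edge_vars V))"
    by (rule poly_ring_idealI)
      (auto simp: toric_kernel_def monomial_map_add toric_map_mult intro: poly_ring_closed)
  have "1 \<in> carrier (poly_ring (edge_vars V) :: (('v edge_var \<Rightarrow>\<^sub>0 nat) \<Rightarrow>\<^sub>0 'k) ring)"
    by (rule poly_ring_closed)
  moreover have "1 \<notin> (toric_kernel V S \<rho> :: (('v edge_var \<Rightarrow>\<^sub>0 nat) \<Rightarrow>\<^sub>0 'k) set)"
    by (simp add: toric_kernel_def toric_map_one)
  ultimately show "carrier (poly_ring (edge_vars V)) \<noteq>
    (toric_kernel V S \<rho> :: (('v edge_var \<Rightarrow>\<^sub>0 nat) \<Rightarrow>\<^sub>0 'k) set)"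
    by blast
next
  fix a b :: "('v edge_var \<Rightarrow>\<^sub>0 nat) \<Rightarrow>\<^sub>0 'k"
  let ?\<phi> = "monomial_map (toric_monomial S \<rho>)"
  assume ab: "a \<in> carrier (poly_ring (edge_vars V))" "b \<in> carrier (poly_ring (edge_vars V))"
    and "a \<otimes>\<^bsub>poly_ring (edge_vars V)\<^esub> b \<in> toric_kernel V S \<rho>"
  then have "?\<phi> a * ?\<phi> b = 0" by (simp add: toric_kernel_def toric_map_mult)
  then have "?\<phi> a = 0 \<or> ?\<phi> b = 0" by (rule divisors_zero)
  then show "a \<in> toric_kernel V S \<rho> \<or> b \<in> toric_kernel V S \<rho>" using ab by (auto simp: toric_kernel_def)
qed (rule cring_poly_ring)

lemma monomial_split:
  assumes "x \<in> Poly_Mapping.keys (m :: 'x \<Rightarrow>\<^sub>0 nat)"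
  obtains m' where "m = Poly_Mapping.single x 1 + m'"
proof
  show "m = Poly_Mapping.single x 1 + (m - Poly_Mapping.single x 1)"
    using assms
    by (intro poly_mapping_eqI) (auto simp: lookup_add lookup_minus lookup_single when_def in_keys_iff)
qed

text \<open>
  Two monomials with the same toric exponent can be moved into each other by exchanging the types of
  two vertices of the same class, and each exchange \<open>x\<^sub>i y\<^sub>j \<rightarrow> x\<^sub>j y\<^sub>i\<close> subtracts a multiple of an
  edge binomial. The induction is on the degree of \<open>m\<close> in the variables \<open>y\<^sub>i\<close>: one such variable of
  \<open>m\<close> is moved into \<open>m'\<close> by at most one exchange and cancelled. When there is none left, the toric
  exponent determines the monomial.
\<close>

lemma toric_fibre_congruent:
  fixes J :: "(('v edge_var \<Rightarrow>\<^sub>0 nat) \<Rightarrow>\<^sub>0 'k::field) set"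
  assumes J: "ideal J (poly_ring (edge_vars V))" and V: "finite V" "W \<subseteq> V"
    and gen: "\<And>i j. i \<in> W \<Longrightarrow> j \<in> W \<Longrightarrow> \<rho> i = \<rho> j \<Longrightarrow> edge_binomial i j \<in> J"
    and m: "Poly_Mapping.keys m \<subseteq> edge_vars W" "Poly_Mapping.keys m' \<subseteq> edge_vars W"
    and eq: "toric_exponent \<rho> m = toric_exponent \<rho> m'"
  shows "Poly_Mapping.single m 1 - Poly_Mapping.single m' 1 \<in> J"
  using m eq
proof (induction "\<Sum>i\<in>V. Poly_Mapping.lookup m (YVar i)" arbitrary: m m' rule: less_induct)
  case less
  note m = less.prems(1,2) and eq = less.prems(3)
  have mult: "Poly_Mapping.single a 1 * p \<in> J" if "p \<in> J" "Poly_Mapping.keys a \<subseteq> edge_vars W" for a p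
    using that image_mono[OF V(2), of XVar] image_mono[OF V(2), of YVar]
    by (intro poly_ring_idealD(5)[OF J] single_in_poly_ring) blast+
  show ?case
  proof (cases "\<exists>i. YVar i \<in> Poly_Mapping.keys m")
    case False
    have "YVar i \<notin> Poly_Mapping.keys m'" for i
      using False toric_exponent_class_pos[of \<rho> m "\<rho> i"] toric_exponent_class_pos[of \<rho> m' "\<rho> i"] eq
      by auto
    then have "Poly_Mapping.lookup m x = Poly_Mapping.lookup m' x" for x
      using False lookup_toric_exponent_vertex[of \<rho> m] lookup_toric_exponent_vertex[of \<rho> m'] eq
      by (cases x) (auto simp: in_keys_iff)
    then have "m = m'" by (rule poly_mapping_eqI)
    then show ?thesis using poly_ring_idealD(2)[OF J] by simp
  next
    case True
    then obtain i where i: "YVar i \<in> Poly_Mapping.keys m" by blast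
    then obtain m1 where m1: "m = Poly_Mapping.single (YVar i) 1 + m1" by (rule monomial_split)
    have iW: "i \<in> W" using i m(1) by auto
    \<comment> \<open>after an exchange modulo \<open>J\<close>, \<open>m'\<close> is divisible by \<open>y\<^sub>i\<close> with quotient \<open>m2\<close>\<close>
    obtain m2 where m2: "Poly_Mapping.keys m2 \<subseteq> edge_vars W"
        "toric_exponent \<rho> (Poly_Mapping.single (YVar i) 1 + m2) = toric_exponent \<rho> m'"
        "Poly_Mapping.single (Poly_Mapping.single (YVar i) 1 + m2) 1 - Poly_Mapping.single m' 1 \<in> J"
    proof (cases "YVar i \<in> Poly_Mapping.keys m'")
      case True
      then obtain m2 where "m' = Poly_Mapping.single (YVar i) 1 + m2" by (rule monomial_split)
      then show thesis
        using that[of m2] m(2) poly_ring_idealD(2)[OF J] by (simp add: keys_add_nat)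
    next
      case False
      \<comment> \<open>the exponent of \<open>a\<^sub>i\<close> forces \<open>x\<^sub>i\<close> into \<open>m'\<close>, that of \<open>t\<^bsub>\<rho> i\<^esub>\<close> some \<open>y\<^sub>j\<close> of the same class\<close>
      have "Poly_Mapping.lookup (toric_exponent \<rho> m) (False, i) \<noteq> 0"
        using i by (simp add: lookup_toric_exponent_vertex in_keys_iff)
      then have "XVar i \<in> Poly_Mapping.keys m'"
        using False by (simp add: eq lookup_toric_exponent_vertex in_keys_iff)
      then obtain m3 where m3: "m' = Poly_Mapping.single (XVar i) 1 + m3" by (rule monomial_split)
      have "\<exists>j. YVar j \<in> Poly_Mapping.keys m' \<and> \<rho> j = \<rho> i"
        using i toric_exponent_class_pos[of \<rho> m "\<rho> i"] toric_exponent_class_pos[of \<rho> m' "\<rho> i"] eq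
        by auto
      then obtain j where j: "YVar j \<in> Poly_Mapping.keys m'" "\<rho> j = \<rho> i" by blast
      then have "YVar j \<in> Poly_Mapping.keys m3" by (simp add: m3 keys_add_nat)
      then obtain m4 where m4: "m3 = Poly_Mapping.single (YVar j) 1 + m4" by (rule monomial_split)
      have jW: "j \<in> W" using j m(2) by auto
      have k4: "Poly_Mapping.keys m4 \<subseteq> edge_vars W" using m(2) by (simp add: m3 m4 keys_add_nat)
      have "Poly_Mapping.single m4 1 * edge_binomial j i \<in> J"
        using gen[OF jW iW j(2)] k4 by (rule mult)
      moreover have "Poly_Mapping.single m4 1 * edge_binomial j i =
        (Poly_Mapping.single (Poly_Mapping.single (YVar i) 1 + (Poly_Mapping.single (XVar j) 1 + m4)) 1 -
         Poly_Mapping.single m' 1 :: ('v edge_var \<Rightarrow>\<^sub>0 nat) \<Rightarrow>\<^sub>0 'k)"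
        by (simp add: edge_binomial_def indet_def mult_single right_diff_distrib m3 m4 add_ac)
      ultimately show thesis
        using that[of "Poly_Mapping.single (XVar j) 1 + m4"] jW k4 j(2)
        by (simp add: keys_add_nat toric_exponent_add toric_exponent_single m3 m4 add_ac)
    qed
    have "(\<Sum>i\<in>V. Poly_Mapping.lookup m1 (YVar i)) < (\<Sum>i\<in>V. Poly_Mapping.lookup m (YVar i))"
      using V iW by (intro sum_strict_mono_ex1) (auto simp: m1 lookup_add lookup_single when_def)
    moreover have "toric_exponent \<rho> (Poly_Mapping.single (YVar i) 1 + m1) =
        toric_exponent \<rho> (Poly_Mapping.single (YVar i) 1 + m2)"
      using eq m2(2) m1 by simp
    then have "toric_exponent \<rho> m1 = toric_exponent \<rho> m2"
      by (simp only: toric_exponent_add add_left_cancel)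
    moreover have "Poly_Mapping.keys m1 \<subseteq> edge_vars W" using m(1) by (simp add: m1 keys_add_nat)
    ultimately have "Poly_Mapping.single m1 1 - Poly_Mapping.single m2 1 \<in> J"
      using m2(1) by (intro less.hyps)
    then have "Poly_Mapping.single (Poly_Mapping.single (YVar i) 1) 1 *
      (Poly_Mapping.single m1 1 - Poly_Mapping.single m2 1) \<in> J"
      using iW by (intro mult) auto
    then have "(Poly_Mapping.single m 1 - Poly_Mapping.single (Poly_Mapping.single (YVar i) 1 + m2) 1) +
      (Poly_Mapping.single (Poly_Mapping.single (YVar i) 1 + m2) 1 - Poly_Mapping.single m' 1) \<in> J"
      using m2(3) by (intro poly_ring_idealD(3)[OF J]) (simp_all add: m1 right_diff_distrib mult_single)
    then show ?thesis by simp
  qed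
qed

text \<open>
  So the toric kernel is generated by the variables of \<open>S\<close> and the edge binomials within the classes. An
  element of the kernel loses a term when a multiple of a generator is subtracted: either a monomial
  containing a variable of \<open>S\<close>, or, since the coefficients over each toric exponent add up to zero, one
  of two monomials with the same toric exponent, which is replaced by the other.
\<close>

lemma toric_kernel_subset:
  fixes J :: "(('v edge_var \<Rightarrow>\<^sub>0 nat) \<Rightarrow>\<^sub>0 'k::field) set"
  assumes J: "ideal J (poly_ring (edge_vars V))" and V: "finite V"
    and var: "\<And>x. x \<in> edge_vars (V \<inter> S) \<Longrightarrow> indet x \<in> J"
    and gen: "\<And>i j. i \<in> V - S \<Longrightarrow> j \<in> V - S \<Longrightarrow> \<rho> i = \<rho> j \<Longrightarrow> edge_binomial i j \<in> J"
  shows "toric_kernel V S \<rho> \<subseteq> J"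
proof
  fix p :: "('v edge_var \<Rightarrow>\<^sub>0 nat) \<Rightarrow>\<^sub>0 'k" assume "p \<in> toric_kernel V S \<rho>"
  then show "p \<in> J"
  proof (induction "card (Poly_Mapping.keys p)" arbitrary: p rule: less_induct)
    case less
    let ?\<phi> = "monomial_map (toric_monomial S \<rho>)"
    have p: "p \<in> carrier (poly_ring (edge_vars V))" "?\<phi> p = 0"
      using less.prems by (auto simp: toric_kernel_def)
    have step: "p \<in> J"
      if q: "q \<in> J" "?\<phi> q = 0" and m: "m \<in> Poly_Mapping.keys p"
        and keys: "Poly_Mapping.keys (p - q) \<subseteq> Poly_Mapping.keys p - {m}" for q m
    proof -
      have "Poly_Mapping.keys (p - q) \<subset> Poly_Mapping.keys p" using m keys by auto
      then have "card (Poly_Mapping.keys (p - q)) < card (Poly_Mapping.keys p)"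
        by (intro psubset_card_mono) auto
      moreover have "p - q \<in> toric_kernel V S \<rho>"
        using p q poly_ring_idealD(1)[OF J]
        by (auto simp: toric_kernel_def monomial_map_diff intro: poly_ring_closed)
      ultimately have "p - q \<in> J" by (rule less.hyps)
      from poly_ring_idealD(3)[OF J this q(1)] show ?thesis by simp
    qed
    show ?case
    proof (cases "\<exists>m\<in>Poly_Mapping.keys p. Poly_Mapping.keys m \<inter> edge_vars S \<noteq> {}")
      case True
      then obtain m x where m: "m \<in> Poly_Mapping.keys p" and x: "x \<in> Poly_Mapping.keys m" "x \<in> edge_vars S"
        by blast
      have mV: "Poly_Mapping.keys m \<subseteq> edge_vars V" using p(1) m by (simp add: carrier_poly_ring)
      obtain m' where m': "m = Poly_Mapping.single x 1 + m'" using x(1) by (rule monomial_split)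
      let ?q = "Poly_Mapping.single m (Poly_Mapping.lookup p m)"
      have "Poly_Mapping.single m' (Poly_Mapping.lookup p m) * indet x \<in> J"
        using mV x
        by (intro poly_ring_idealD(5)[OF J] single_in_poly_ring var) (auto simp: m' keys_add_nat)
      then have "?q \<in> J" by (simp add: indet_def mult_single m' add.commute)
      moreover have "?\<phi> ?q = 0"
        using x by (auto simp: monomial_map_single toric_monomial_def)
      moreover have "Poly_Mapping.keys (p - ?q) \<subseteq> Poly_Mapping.keys p - {m}"
      proof
        fix a assume "a \<in> Poly_Mapping.keys (p - ?q)"
        then have "Poly_Mapping.lookup p a - (Poly_Mapping.lookup p m when m = a) \<noteq> 0"
          by (simp add: in_keys_iff lookup_minus lookup_single)
        then show "a \<in> Poly_Mapping.keys p - {m}"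
          using m by (cases "m = a") (simp_all add: in_keys_iff)
      qed
      ultimately show ?thesis using m by (intro step)
    next
      case False
      show ?thesis
      proof (cases "p = 0")
        case True then show ?thesis using poly_ring_idealD(2)[OF J] by simp
      next
        assume "p \<noteq> 0"
        then obtain m where m: "m \<in> Poly_Mapping.keys p" by (metis ex_in_conv keys_eq_empty)
        have "(\<Sum>m' | m' \<in> Poly_Mapping.keys p \<and> toric_exponent \<rho> m' = toric_exponent \<rho> m.
          Poly_Mapping.lookup p m') = 0"
          using lookup_toric_map[of p S \<rho> "toric_exponent \<rho> m"] False p(2) by auto
        moreover have "Poly_Mapping.lookup p m \<noteq> 0" using m by (simp add: in_keys_iff)
        ultimately have "{m' \<in> Poly_Mapping.keys p. toric_exponent \<rho> m' = toric_exponent \<rho> m} \<noteq> {m}"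
          by auto
        moreover have "m \<in> {m' \<in> Poly_Mapping.keys p. toric_exponent \<rho> m' = toric_exponent \<rho> m}"
          using m by simp
        ultimately obtain m' where "m' \<in> {m' \<in> Poly_Mapping.keys p. toric_exponent \<rho> m' = toric_exponent \<rho> m}"
          and "m' \<noteq> m" by blast
        then have m': "m' \<in> Poly_Mapping.keys p" "m' \<noteq> m" "toric_exponent \<rho> m = toric_exponent \<rho> m'"
          by simp_all
        let ?c = "Poly_Mapping.lookup p m"
        let ?q = "Poly_Mapping.single 0 ?c * (Poly_Mapping.single m 1 - Poly_Mapping.single m' 1)"
        have free: "Poly_Mapping.keys a \<subseteq> edge_vars (V - S)" if "a \<in> Poly_Mapping.keys p" for a
        proof
          fix x assume "x \<in> Poly_Mapping.keys a"
          moreover have "Poly_Mapping.keys a \<subseteq> edge_vars V"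
            using p(1) that by (simp add: carrier_poly_ring)
          moreover have "Poly_Mapping.keys a \<inter> edge_vars S = {}" using False that by blast
          ultimately have "x \<in> edge_vars V" "x \<notin> edge_vars S" by blast+
          then show "x \<in> edge_vars (V - S)" by blast
        qed
        have "Poly_Mapping.single m 1 - Poly_Mapping.single m' 1 \<in> J"
          by (rule toric_fibre_congruent[OF J V Diff_subset gen free[OF m] free[OF m'(1)] m'(3)])
        then have "?q \<in> J" by (intro poly_ring_idealD(5)[OF J] const_in_poly_ring)
        moreover have "toric_monomial S \<rho> m = (toric_monomial S \<rho> m' :: _ \<Rightarrow>\<^sub>0 'k)"
          using False m m' by (simp add: toric_monomial_def)
        then have "?\<phi> ?q = 0"
          by (simp add: right_diff_distrib mult_single monomial_map_diff monomial_map_single)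
        moreover have "Poly_Mapping.keys (p - ?q) \<subseteq> Poly_Mapping.keys p - {m}"
        proof
          fix a assume "a \<in> Poly_Mapping.keys (p - ?q)"
          then have "Poly_Mapping.lookup p a - ((?c when m = a) - (?c when m' = a)) \<noteq> 0"
            by (simp add: in_keys_iff right_diff_distrib mult_single lookup_minus lookup_single)
          then show "a \<in> Poly_Mapping.keys p - {m}"
            using m m' by (cases "m = a"; cases "m' = a") (simp_all add: in_keys_iff)
        qed
        ultimately show ?thesis using m by (intro step)
      qed
    qed
  qed
qed

text \<open>
  The images of these indeterminates are algebraically independent: from the toric exponent of a
  monomial in them the \<open>y\<close>-degrees are read off first, as no two of the vertices in \<open>W'\<close> share a class,
  and then the \<open>x\<close>-degrees.
\<close>

lemma toric_kernel_indets_independent: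
  fixes p :: "('v edge_var \<Rightarrow>\<^sub>0 nat) \<Rightarrow>\<^sub>0 'k::field"
  assumes W: "W \<inter> S = {}" "W' \<inter> S = {}" "inj_on \<rho> W'"
    and p: "p \<in> carrier (poly_ring (XVar ` W \<union> YVar ` W'))" "p \<in> toric_kernel V S \<rho>"
  shows "p = 0"
proof (rule ccontr)
  assume "p \<noteq> 0"
  then obtain m where m: "m \<in> Poly_Mapping.keys p" by (metis ex_in_conv keys_eq_empty)
  have vars: "Poly_Mapping.keys a \<subseteq> XVar ` W \<union> YVar ` W'" if "a \<in> Poly_Mapping.keys p" for a
    using p(1) that by (simp add: carrier_poly_ring)
  have Y: "Poly_Mapping.lookup a (YVar i) = Poly_Mapping.lookup (toric_exponent \<rho> a) (True, \<rho> i)"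
    if "a \<in> Poly_Mapping.keys p" "i \<in> W'" for a i
  proof -
    have "j = i" if "YVar j \<in> Poly_Mapping.keys a" "\<rho> j = \<rho> i" for j
      using that vars[OF \<open>a \<in> _\<close>] W(3) \<open>i \<in> W'\<close> by (auto simp: inj_on_def)
    then have "{j. YVar j \<in> Poly_Mapping.keys a \<and> \<rho> j = \<rho> i} =
      (if YVar i \<in> Poly_Mapping.keys a then {i} else {})" by auto
    then show ?thesis by (simp add: lookup_toric_exponent_class in_keys_iff)
  qed
  have inj: "a = m" if a: "a \<in> Poly_Mapping.keys p" "toric_exponent \<rho> a = toric_exponent \<rho> m" for a
  proof (rule poly_mapping_eqI)
    have y: "Poly_Mapping.lookup a (YVar i) = Poly_Mapping.lookup m (YVar i)" for i
    proof (cases "i \<in> W'")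
      case True then show ?thesis using Y[OF a(1)] Y[OF m] a(2) by simp
    next
      case False
      then have "YVar i \<notin> Poly_Mapping.keys a" "YVar i \<notin> Poly_Mapping.keys m"
        using vars[OF a(1)] vars[OF m] by auto
      then show ?thesis by (simp add: in_keys_iff)
    qed
    have "Poly_Mapping.lookup a (XVar i) = Poly_Mapping.lookup m (XVar i)" for i
      using y[of i] a(2) lookup_toric_exponent_vertex[of \<rho> a i] lookup_toric_exponent_vertex[of \<rho> m i]
      by simp
    then show "Poly_Mapping.lookup a x = Poly_Mapping.lookup m x" for x
      using y by (cases x) auto
  qed
  have "Poly_Mapping.keys a \<inter> edge_vars S = {}" if "a \<in> Poly_Mapping.keys p" for a
    using vars[OF that] W(1,2) by auto
  then have "(\<Sum>a | a \<in> Poly_Mapping.keys p \<and> toric_exponent \<rho> a = toric_exponent \<rho> m.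
      Poly_Mapping.lookup p a) = 0"
    using lookup_toric_map[of p S \<rho> "toric_exponent \<rho> m"] p(2) by (auto simp: toric_kernel_def)
  moreover have "{a. a \<in> Poly_Mapping.keys p \<and> toric_exponent \<rho> a = toric_exponent \<rho> m} = {m}"
    using inj m by auto
  ultimately show False using m by (simp add: in_keys_iff)
qed

section \<open>Heights and associated primes among the toric kernels\<close>

lemma toric_map_power:
  "monomial_map (toric_monomial S \<rho>) (p ^ k) = monomial_map (toric_monomial S \<rho>) p ^ k"
  by (induction k) (simp_all add: toric_map_one toric_map_mult)

lemma toric_map_prod:
  "monomial_map (toric_monomial S \<rho>) (prod f I) = (\<Prod>i\<in>I. monomial_map (toric_monomial S \<rho>) (f i))"
  by (induction I rule: infinite_finite_induct) (simp_all add: toric_map_one toric_map_mult)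

lemma toric_map_indet_eq_0_iff:
  "monomial_map (toric_monomial S \<rho>) (indet x :: _ \<Rightarrow>\<^sub>0 'k::field) = 0 \<longleftrightarrow> x \<in> edge_vars S"
proof -
  have "Poly_Mapping.single e (1 :: 'k) \<noteq> 0" for e :: "bool \<times> 'a \<Rightarrow>\<^sub>0 nat"
    by (metis lookup_single_eq lookup_zero zero_neq_one)
  then show ?thesis by (simp add: toric_map_indet)
qed

lemma edge_binomial_in_toric_kernel_iff:
  "i \<in> V \<Longrightarrow> j \<in> V \<Longrightarrow>
    edge_binomial i j \<in> toric_kernel V S \<rho> \<longleftrightarrow> i \<in> S \<or> j \<in> S \<or> \<rho> i = \<rho> j"
  by (simp add: toric_kernel_def edge_binomial_in_poly_ring toric_map_edge_binomial_eq_0_iff)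

lemma toric_kernel_mono:
  fixes V :: "'v::linorder set"
  assumes "finite V" "\<And>i j. i \<in> V \<Longrightarrow> j \<in> V \<Longrightarrow> \<rho> i = \<rho> j \<Longrightarrow> \<rho>' i = \<rho>' j"
  shows "toric_kernel V {} \<rho> \<subseteq> (toric_kernel V {} \<rho>' :: (('v edge_var \<Rightarrow>\<^sub>0 nat) \<Rightarrow>\<^sub>0 'k::field) set)"
proof (rule toric_kernel_subset)
  show "ideal (toric_kernel V {} \<rho>' :: (('v edge_var \<Rightarrow>\<^sub>0 nat) \<Rightarrow>\<^sub>0 'k) set) (poly_ring (edge_vars V))"
    by (rule poly_ring_primeidealD(1)[OF primeideal_toric_kernel])
  show "edge_binomial i j \<in> toric_kernel V {} \<rho>'" if "i \<in> V - {}" "j \<in> V - {}" "\<rho> i = \<rho> j" for i j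
    using that assms(2)[of i j] by (simp add: edge_binomial_in_toric_kernel_iff)
qed (use assms(1) in simp_all)

text \<open>
  Starting from singletons and merging one vertex after the other into a single class gives a
  strictly increasing chain of toric kernels with \<open>card V - 1\<close> steps; the merged vertex contributes
  a new edge binomial.
\<close>

lemma height_toric_kernel_ge:
  fixes V :: "'v::linorder set"
  assumes V: "finite V" "V \<noteq> {}" and \<rho>: "\<And>i j. i \<in> V \<Longrightarrow> j \<in> V \<Longrightarrow> \<rho> i = \<rho> j"
  shows "enat (card V - 1) \<le> height (poly_ring (edge_vars V))
    (toric_kernel V {} \<rho> :: (('v edge_var \<Rightarrow>\<^sub>0 nat) \<Rightarrow>\<^sub>0 'k::field) set)"
proof -
  obtain f where f: "bij_betw f {0..<card V} V" using ex_bij_betw_nat_finite[OF V(1)] by blast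
  define n where "n = card V - 1"
  have card: "card V = Suc n" using V by (simp add: n_def card_gt_0_iff)
  have fV: "f k \<in> V" if "k \<le> n" for k using f that card by (auto simp: bij_betw_def)
  have inj: "f a = f b \<longleftrightarrow> a = b" if "a \<le> n" "b \<le> n" for a b
    using f that card by (auto simp: bij_betw_def inj_on_def)
  have surj: "V = f ` {..n}" using f card by (auto simp: bij_betw_def less_Suc_eq_le atMost_def)
  define \<sigma> where "\<sigma> k i = (if i \<in> f ` {..k} then f 0 else i)" for k i
  define c :: "nat \<Rightarrow> (('v edge_var \<Rightarrow>\<^sub>0 nat) \<Rightarrow>\<^sub>0 'k) set" where "c k = toric_kernel V {} (\<sigma> k)" for k
  have "c k \<subset> c (Suc k)" if k: "k < n" for k
  proof
    show "c k \<subseteq> c (Suc k)"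
      unfolding c_def by (rule toric_kernel_mono[OF V(1)]) (auto simp: \<sigma>_def split: if_splits)
    have "\<sigma> k (f 0) \<noteq> \<sigma> k (f (Suc k))" "\<sigma> (Suc k) (f 0) = \<sigma> (Suc k) (f (Suc k))"
      using k inj by (auto simp: \<sigma>_def)
    then have "edge_binomial (f 0) (f (Suc k)) \<in> c (Suc k)" "edge_binomial (f 0) (f (Suc k)) \<notin> c k"
      using fV k by (simp_all add: c_def edge_binomial_in_toric_kernel_iff)
    then show "c k \<noteq> c (Suc k)" by blast
  qed
  moreover have "c n = toric_kernel V {} \<rho>"
    unfolding c_def
  proof (rule equalityI; rule toric_kernel_mono[OF V(1)])
    show "\<rho> i = \<rho> j" if "i \<in> V" "j \<in> V" for i j using that by (rule \<rho>)
    show "\<sigma> n i = \<sigma> n j" if "i \<in> V" "j \<in> V" for i j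
      using that unfolding \<sigma>_def surj[symmetric] by simp
  qed
  moreover have "primeideal (c k) (poly_ring (edge_vars V))" for k
    unfolding c_def by (rule primeideal_toric_kernel)
  ultimately show ?thesis
    unfolding height_def n_def[symmetric] by (intro Sup_upper) blast
qed

lemma height_toric_kernel_le:
  fixes V :: "'v::linorder set"
  assumes V: "finite V" and W: "W \<subseteq> V - S" "W' \<subseteq> V - S" "inj_on \<rho> W'"
  shows "height (poly_ring (edge_vars V))
    (toric_kernel V S \<rho> :: (('v edge_var \<Rightarrow>\<^sub>0 nat) \<Rightarrow>\<^sub>0 'k::field) set) \<le> enat (2 * card V - (card W + card W'))"
proof -
  have fin: "finite W" "finite W'" using W V finite_subset by blast+
  have card: "card (XVar ` X \<union> YVar ` Y) = card X + card Y" if "finite X" "finite Y" for X Y :: "'v set"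
    using that by (subst card_Un_disjoint) (auto simp: card_image inj_on_def)
  have "height (poly_ring (edge_vars V)) (toric_kernel V S \<rho> :: (('v edge_var \<Rightarrow>\<^sub>0 nat) \<Rightarrow>\<^sub>0 'k) set) \<le>
    enat (card (edge_vars V) - card (XVar ` W \<union> YVar ` W'))"
  proof (rule height_le_if_indets_independent)
    show "XVar ` W \<union> YVar ` W' \<subseteq> edge_vars V" using W by blast
    show "p = 0" if "p \<in> carrier (poly_ring (XVar ` W \<union> YVar ` W'))" "p \<in> toric_kernel V S \<rho>"
      for p :: "('v edge_var \<Rightarrow>\<^sub>0 nat) \<Rightarrow>\<^sub>0 'k"
      using W that by (intro toric_kernel_indets_independent[of W S W' \<rho> p V]) auto
  qed (use V in auto)
  then show ?thesis using card V fin by (simp add: mult_2)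
qed

text \<open>
  The inclusion of the toric kernel in the colon ideal \<open>(J : f)\<close> need only be checked on its generators; the
  converse inclusion holds because the toric kernel is prime, contains \<open>J\<close>, and does not contain \<open>f\<close>.
\<close>

lemma toric_kernel_associated:
  fixes J :: "(('v::linorder edge_var \<Rightarrow>\<^sub>0 nat) \<Rightarrow>\<^sub>0 'k::field) set"
  assumes V: "finite V" and J: "ideal J (poly_ring (edge_vars V))" "J \<subseteq> toric_kernel V S \<rho>"
    and f: "f \<in> carrier (poly_ring (edge_vars V))" "f \<notin> toric_kernel V S \<rho>"
    and var: "\<And>x. x \<in> edge_vars (V \<inter> S) \<Longrightarrow> indet x * f \<in> J"
    and gen: "\<And>i j. i \<in> V - S \<Longrightarrow> j \<in> V - S \<Longrightarrow> \<rho> i = \<rho> j \<Longrightarrow> edge_binomial i j * f \<in> J"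
  shows "toric_kernel V S \<rho> \<in> associated_primes (poly_ring (edge_vars V)) J"
proof -
  let ?R = "poly_ring (edge_vars V) :: (('v edge_var \<Rightarrow>\<^sub>0 nat) \<Rightarrow>\<^sub>0 'k) ring"
  let ?Q = "{a \<in> carrier ?R. a * f \<in> J}"
  have prime: "primeideal (toric_kernel V S \<rho>) ?R" by (rule primeideal_toric_kernel)
  have "ideal ?Q ?R"
    by (rule poly_ring_idealI)
      (auto simp: distrib_right mult.assoc intro: poly_ring_closed poly_ring_idealD[OF J(1)])
  then have "toric_kernel V S \<rho> \<subseteq> ?Q"
  proof (rule toric_kernel_subset[OF _ V])
    show "indet x \<in> ?Q" if "x \<in> edge_vars (V \<inter> S)" for x
      using var[OF that] that by (auto intro!: indet_in_poly_ring)
    show "edge_binomial i j \<in> ?Q" if "i \<in> V - S" "j \<in> V - S" "\<rho> i = \<rho> j" for i j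
      using gen[OF that] that by (auto intro: edge_binomial_in_poly_ring)
  qed
  moreover have "?Q \<subseteq> toric_kernel V S \<rho>"
    using poly_ring_primeidealD(3)[OF prime _ f(1)] f(2) J(2) by blast
  ultimately have "toric_kernel V S \<rho> = ?Q" by blast
  then show ?thesis using prime f(1) by (auto simp: associated_primes_def)
qed

section \<open>Binomial edge ideals and connected components\<close>

lemma edge_ring_eq: "edge_ring G = poly_ring (edge_vars (pverts G))"
  by (simp add: edge_ring_def)

text \<open>
  Each edge enters the generators in one orientation only; reversing it changes the sign of the
  binomial.
\<close>

lemma ideal_binomial_edge_ideal:
  fixes G :: "'v::linorder pair_pre_digraph"
  assumes "pair_graph G"
  shows "ideal (binomial_edge_ideal G :: (('v edge_var \<Rightarrow>\<^sub>0 nat) \<Rightarrow>\<^sub>0 'k::field) set)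
      (poly_ring (edge_vars (pverts G)))"
    and "(i, j) \<in> parcs G \<Longrightarrow>
      edge_binomial i j \<in> (binomial_edge_ideal G :: (('v edge_var \<Rightarrow>\<^sub>0 nat) \<Rightarrow>\<^sub>0 'k) set)"
    and "ideal I (poly_ring (edge_vars (pverts G))) \<Longrightarrow>
      (\<And>i j. (i, j) \<in> parcs G \<Longrightarrow> edge_binomial i j \<in> I) \<Longrightarrow>
      binomial_edge_ideal G \<subseteq> (I :: (('v edge_var \<Rightarrow>\<^sub>0 nat) \<Rightarrow>\<^sub>0 'k) set)"
proof -
  interpret pair_graph G by fact
  let ?R = "poly_ring (edge_vars (pverts G)) :: (('v edge_var \<Rightarrow>\<^sub>0 nat) \<Rightarrow>\<^sub>0 'k) ring"
  interpret R: cring ?R by (rule cring_poly_ring)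
  define B :: "(('v edge_var \<Rightarrow>\<^sub>0 nat) \<Rightarrow>\<^sub>0 'k) set"
    where "B = {edge_binomial i j |i j. (i, j) \<in> parcs G \<and> i < j}"
  have Idl: "binomial_edge_ideal G = Idl\<^bsub>?R\<^esub> B"
    by (simp add: binomial_edge_ideal_def edge_ring_eq B_def edge_binomial_def)
  have verts: "i \<in> pverts G" "j \<in> pverts G" "i \<noteq> j" if "(i, j) \<in> parcs G" for i j
    using arc_fst_in_verts[OF that] arc_snd_in_verts[OF that] pair_no_loops[OF that] by auto
  then have B: "B \<subseteq> carrier ?R" by (auto simp: B_def intro: edge_binomial_in_poly_ring)
  show ideal: "ideal (binomial_edge_ideal G :: (('v edge_var \<Rightarrow>\<^sub>0 nat) \<Rightarrow>\<^sub>0 'k) set) ?R"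
    unfolding Idl by (rule R.genideal_ideal[OF B])
  have self: "B \<subseteq> binomial_edge_ideal G" unfolding Idl by (rule R.genideal_self[OF B])
  show "edge_binomial i j \<in> (binomial_edge_ideal G :: (('v edge_var \<Rightarrow>\<^sub>0 nat) \<Rightarrow>\<^sub>0 'k) set)"
    if ij: "(i, j) \<in> parcs G"
  proof (cases "i < j")
    case True then show ?thesis using ij self by (auto simp: B_def)
  next
    case False
    moreover have "(j, i) \<in> parcs G"
      using ij pair_sym_arcs by (auto simp: symmetric_def dest: symD)
    moreover have "j < i" using verts(3)[OF ij] False by simp
    ultimately have "edge_binomial j i \<in> (binomial_edge_ideal G :: (('v edge_var \<Rightarrow>\<^sub>0 nat) \<Rightarrow>\<^sub>0 'k) set)"
      using self unfolding B_def by blast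
    from poly_ring_idealD(4)[OF ideal poly_ring_idealD(2)[OF ideal] this]
    show ?thesis by (simp add: edge_binomial_def)
  qed
  show "binomial_edge_ideal G \<subseteq> I"
    if "ideal I ?R" "\<And>i j. (i, j) \<in> parcs G \<Longrightarrow> edge_binomial i j \<in> I"
    unfolding Idl using that by (intro R.genideal_minimal) (auto simp: B_def)
qed

lemma component_representatives:
  assumes "pair_graph H"
  obtains \<rho> where "\<And>u. u \<in> pverts H \<Longrightarrow> \<rho> u \<in> pverts H" "\<And>u. u \<in> pverts H \<Longrightarrow> \<rho> (\<rho> u) = \<rho> u"
    "\<And>u w. u \<in> pverts H \<Longrightarrow> w \<in> pverts H \<Longrightarrow> \<rho> u = \<rho> w \<longleftrightarrow> u \<rightarrow>\<^sup>*\<^bsub>with_proj H\<^esub> w"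
    "card (\<rho> ` pverts H) = card (components H)"
proof -
  interpret pair_graph H by fact
  let ?V = "pverts H"
  have scc_iff: "scc_of u = scc_of w \<longleftrightarrow> u \<rightarrow>\<^sup>*\<^bsub>with_proj H\<^esub> w" if "u \<in> ?V" "w \<in> ?V" for u w
  proof
    assume "scc_of u = scc_of w"
    then have "u \<in> scc_of w" using in_scc_of_self[of u] that by simp
    then show "u \<rightarrow>\<^sup>*\<^bsub>with_proj H\<^esub> w" by (simp add: scc_of_def)
  next
    assume uw: "u \<rightarrow>\<^sup>*\<^bsub>with_proj H\<^esub> w"
    then have "w \<rightarrow>\<^sup>*\<^bsub>with_proj H\<^esub> u" by (rule symmetric_reachable[OF sym_arcs])
    with uw show "scc_of u = scc_of w"
      unfolding scc_of_def using reachable_trans by blast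
  qed
  define \<rho> where "\<rho> u = (SOME w. w \<in> scc_of u)" for u
  have \<rho>: "\<rho> u \<in> scc_of u" if "u \<in> ?V" for u
  proof -
    have "u \<in> scc_of u" using in_scc_of_self[of u] that by simp
    then show ?thesis unfolding \<rho>_def by (rule someI)
  qed
  have \<rho>V: "\<rho> u \<in> ?V" if "u \<in> ?V" for u
    using \<rho>[OF that] reachable_in_verts(2)[of u "\<rho> u"] by (auto simp: scc_of_def)
  have scc\<rho>: "scc_of (\<rho> u) = scc_of u" if "u \<in> ?V" for u
    using scc_iff[OF \<rho>V[OF that] that] \<rho>[OF that] by (simp add: scc_of_def)
  have eq: "\<rho> u = \<rho> w \<longleftrightarrow> scc_of u = scc_of w" if "u \<in> ?V" "w \<in> ?V" for u w
  proof
    assume "\<rho> u = \<rho> w"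
    then show "scc_of u = scc_of w" using scc\<rho>[OF that(1)] scc\<rho>[OF that(2)] by metis
  qed (simp add: \<rho>_def)
  have "inj_on scc_of (\<rho> ` ?V)" using eq scc\<rho> by (auto simp: inj_on_def)
  then have "card (\<rho> ` ?V) = card (scc_of ` \<rho> ` ?V)" by (simp add: card_image)
  also have "scc_of ` \<rho> ` ?V = scc_of ` ?V" using scc\<rho> by (force simp: image_iff)
  also have "card (scc_of ` ?V) = card (components H)"
    using sccs_verts_conv_scc_of card_sccs_verts by (simp add: components_def)
  finally have card: "card (\<rho> ` ?V) = card (components H)" .
  show thesis
  proof (rule that[of \<rho>])
    show "\<rho> u = \<rho> w \<longleftrightarrow> u \<rightarrow>\<^sup>*\<^bsub>with_proj H\<^esub> w" if "u \<in> ?V" "w \<in> ?V" for u w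
      using eq[OF that] scc_iff[OF that] by simp
    show "\<rho> (\<rho> u) = \<rho> u" if "u \<in> ?V" for u
      using eq[OF \<rho>V[OF that] that] scc\<rho>[OF that] by simp
  qed (use \<rho>V card in auto)
qed

text \<open>
  With \<open>g\<^bsub>i j\<^esub>\<close> for the edge binomials, the identity \<open>x\<^sub>k g\<^bsub>i l\<^esub> = x\<^sub>i g\<^bsub>k l\<^esub> + x\<^sub>l g\<^bsub>i k\<^esub>\<close> extends a walk
  from \<open>i\<close> to \<open>k\<close> by an edge to \<open>l\<close>, at the cost of a factor \<open>x\<^sub>k\<close>. Taking the product of all
  \<open>x\<^sub>u\<close> as the factor, one exponent serves all pairs of vertices, as there are finitely many.
\<close>

lemma reachable_binomial_in_ideal:
  fixes J :: "(('v edge_var \<Rightarrow>\<^sub>0 nat) \<Rightarrow>\<^sub>0 'k::field) set"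
  assumes H: "pair_graph H" "pverts H \<subseteq> V" and J: "ideal J (poly_ring (edge_vars V))"
    and edges: "\<And>i j. (i, j) \<in> parcs H \<Longrightarrow> edge_binomial i j \<in> J"
  obtains K where "\<And>i j. i \<rightarrow>\<^sup>*\<^bsub>with_proj H\<^esub> j \<Longrightarrow>
    (\<Prod>u\<in>pverts H. indet (XVar u)) ^ K * edge_binomial i j \<in> J"
proof -
  interpret pair_graph H by fact
  define h :: "('v edge_var \<Rightarrow>\<^sub>0 nat) \<Rightarrow>\<^sub>0 'k" where "h = (\<Prod>u\<in>pverts H. indet (XVar u))"
  have X: "indet (XVar u) \<in> carrier (poly_ring (edge_vars V))" if "u \<in> pverts H" for u
    using that H(2) by (intro indet_in_poly_ring) auto
  have h: "h \<in> carrier (poly_ring (edge_vars V))"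
    unfolding h_def by (intro poly_ring_prod_closed X)
  have mult: "p * q \<in> J" if "p \<in> carrier (poly_ring (edge_vars V))" "q \<in> J" for p q
    using that by (rule poly_ring_idealD(5)[OF J])
  have ex: "\<exists>k. h ^ k * edge_binomial i j \<in> J" if "i \<rightarrow>\<^sup>*\<^bsub>with_proj H\<^esub> j" for i j
    using that
  proof (induction rule: reachable_induct)
    case base
    then show ?case using poly_ring_idealD(2)[OF J] by (simp add: edge_binomial_def)
  next
    case (step x y)
    then obtain k where k: "h ^ k * edge_binomial i x \<in> J" by blast
    have xy: "(x, y) \<in> parcs H" using step.hyps by auto
    have verts: "i \<in> pverts H" "x \<in> pverts H" "y \<in> pverts H"
      using reachable_in_verts[OF step.hyps(1)] arc_snd_in_verts[OF xy] by auto
    define h' :: "('v edge_var \<Rightarrow>\<^sub>0 nat) \<Rightarrow>\<^sub>0 'k" where "h' = (\<Prod>u\<in>pverts H - {x}. indet (XVar u))"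
    have h': "h = indet (XVar x) * h'"
      unfolding h_def h'_def using verts(2) pair_finite_verts by (simp add: prod.remove)
    have h'c: "h' \<in> carrier (poly_ring (edge_vars V))"
      unfolding h'_def by (intro poly_ring_prod_closed X) simp
    have "h ^ Suc k * edge_binomial i y =
      (h' * h ^ k * indet (XVar i)) * edge_binomial x y + (h' * indet (XVar y)) * (h ^ k * edge_binomial i x)"
      by (simp add: h' edge_binomial_def algebra_simps)
    also have "\<dots> \<in> J"
      by (intro poly_ring_idealD(3)[OF J] mult k edges xy poly_ring_closed h'c X verts
          poly_ring_power_closed h)
    finally show ?case ..
  qed
  define k where "k p = (SOME n. h ^ n * edge_binomial (fst p) (snd p) \<in> J)" for p
  have k: "h ^ k (i, j) * edge_binomial i j \<in> J" if "i \<rightarrow>\<^sup>*\<^bsub>with_proj H\<^esub> j" for i j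
    unfolding k_def fst_conv snd_conv by (rule someI_ex[OF ex[OF that]])
  define K where "K = (\<Sum>p\<in>pverts H \<times> pverts H. k p)"
  show thesis
  proof (rule that[of K], fold h_def)
    fix i j assume ij: "i \<rightarrow>\<^sup>*\<^bsub>with_proj H\<^esub> j"
    then have "(i, j) \<in> pverts H \<times> pverts H" using reachable_in_verts[OF ij] by simp
    then have "k (i, j) \<le> K"
      unfolding K_def using pair_finite_verts by (intro member_le_sum) auto
    then have "h ^ K * edge_binomial i j = h ^ (K - k (i, j)) * (h ^ k (i, j) * edge_binomial i j)"
      by (simp flip: power_add mult.assoc)
    also have "\<dots> \<in> J" by (intro mult poly_ring_power_closed h k ij)
    finally show "h ^ K * edge_binomial i j \<in> J" .
  qed
qed

text \<open>
  For an apex \<open>v\<close> of a cone the right-hand sides lie in the binomial edge ideal, since \<open>v\<close> is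
  joined to both \<open>i\<close> and \<open>j\<close>.
\<close>

lemma indet_apex_mult_edge_binomial:
  "indet (XVar v) * edge_binomial i j =
     indet (XVar i) * edge_binomial v j - indet (XVar j) * edge_binomial v i"
  "indet (YVar v) * edge_binomial i j =
     indet (YVar i) * edge_binomial v j - indet (YVar j) * edge_binomial v i"
  by (simp_all add: edge_binomial_def algebra_simps)

section \<open>Cones with an unmixed binomial edge ideal\<close>

theorem lemma3p4:
  fixes H G :: "'v::linorder pair_pre_digraph" and v :: 'v
  assumes "pair_graph H"
    and "1 \<le> card (components H)"
    and "v \<notin> pverts H"
    and "G = cone v H"
    and "unmixed (edge_ring G)
           (binomial_edge_ideal G :: (('v edge_var \<Rightarrow>\<^sub>0 nat) \<Rightarrow>\<^sub>0 'k::field) set)"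
  shows "card (components H) \<le> 2"
proof (rule ccontr)
  assume "\<not> card (components H) \<le> 2"
  then have r: "card (components H) \<ge> 3" by simp
  interpret H: pair_graph H by fact
  have G: "pair_graph G" using pair_graph_cone[OF assms(1,3)] assms(4) by simp
  let ?U = "pverts H" and ?V = "pverts G"
  let ?J = "binomial_edge_ideal G :: (('v edge_var \<Rightarrow>\<^sub>0 nat) \<Rightarrow>\<^sub>0 'k) set"
  let ?R = "poly_ring (edge_vars ?V) :: (('v edge_var \<Rightarrow>\<^sub>0 nat) \<Rightarrow>\<^sub>0 'k) ring"
  have V: "?V = insert v ?U" by (simp add: assms(4) cone_def)
  have fin: "finite ?U" "finite ?V" using H.pair_finite_verts V by auto
  have cardV: "card ?V = Suc (card ?U)" using V fin assms(3) by simp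
  note J = ideal_binomial_edge_ideal(1)[OF G, where 'k = 'k]
  note edge = ideal_binomial_edge_ideal(2)[OF G, where 'k = 'k]
  note J_least = ideal_binomial_edge_ideal(3)[OF G, where 'k = 'k]
  have H_edge: "edge_binomial i j \<in> ?J" if "(i, j) \<in> parcs H" for i j
    using that by (intro edge) (simp add: assms(4) cone_def)
  have v_edge: "edge_binomial v i \<in> ?J" if "i \<in> ?U" for i
    using that by (intro edge) (simp add: assms(4) cone_def)
  have X: "indet (XVar i) \<in> carrier ?R" and Y: "indet (YVar i) \<in> carrier ?R" if "i \<in> ?V" for i
    using that by (auto intro!: indet_in_poly_ring)
  have verts: "i \<in> ?U" "j \<in> ?U" if "(i, j) \<in> parcs H" for i j
    using H.arc_fst_in_verts[OF that] H.arc_snd_in_verts[OF that] by auto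
  have G_edge: "i \<in> ?V" "j \<in> ?V" "i = v \<or> j = v \<or> (i, j) \<in> parcs H" if "(i, j) \<in> parcs G" for i j
    using that verts by (auto simp: assms(4) cone_def)
  have apexX: "indet (XVar v) * edge_binomial i j \<in> ?J"
    and apexY: "indet (YVar v) * edge_binomial i j \<in> ?J" if "i \<in> ?V" "j \<in> ?V" for i j
  proof -
    have "edge_binomial v i \<in> ?J" if "i \<in> ?V" for i
      using that v_edge poly_ring_idealD(2)[OF J] V by (auto simp: edge_binomial_def)
    then have "edge_binomial v i \<in> ?J" "edge_binomial v j \<in> ?J" using that by auto
    then have "x * edge_binomial v j - y * edge_binomial v i \<in> ?J"
      if "x \<in> carrier ?R" "y \<in> carrier ?R" for x y
      using that by (intro poly_ring_idealD(4)[OF J] poly_ring_idealD(5)[OF J])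
    from this[OF X X] this[OF Y Y] that
    show "indet (XVar v) * edge_binomial i j \<in> ?J" "indet (YVar v) * edge_binomial i j \<in> ?J"
      unfolding indet_apex_mult_edge_binomial[of v i j] by blast+
  qed

  \<comment> \<open>the ideal of the complete graph on all vertices, which is \<open>(J : x\<^sub>v)\<close>\<close>
  let ?P = "toric_kernel ?V {} (\<lambda>_. v) :: (('v edge_var \<Rightarrow>\<^sub>0 nat) \<Rightarrow>\<^sub>0 'k) set"
  have P_ass: "?P \<in> associated_primes ?R ?J"
  proof (rule toric_kernel_associated[OF fin(2) J, where f = "indet (XVar v)"])
    show "?J \<subseteq> ?P"
      using G_edge(1,2)
      by (intro J_least poly_ring_primeidealD(1) primeideal_toric_kernel)
        (simp add: edge_binomial_in_toric_kernel_iff)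
    show "indet (XVar v) \<in> carrier ?R" using V by (intro X) simp
    show "indet (XVar v) \<notin> ?P" by (simp add: toric_kernel_def toric_map_indet_eq_0_iff)
    show "edge_binomial i j * indet (XVar v) \<in> ?J" if "i \<in> ?V - {}" "j \<in> ?V - {}" for i j
      using apexX[of i j] that unfolding mult.commute[of "edge_binomial i j"] by simp
  qed simp

  obtain \<rho> where \<rho>U: "\<And>u. u \<in> ?U \<Longrightarrow> \<rho> u \<in> ?U" and \<rho>\<rho>: "\<And>u. u \<in> ?U \<Longrightarrow> \<rho> (\<rho> u) = \<rho> u"
    and \<rho>: "\<And>u w. u \<in> ?U \<Longrightarrow> w \<in> ?U \<Longrightarrow> \<rho> u = \<rho> w \<longleftrightarrow> u \<rightarrow>\<^sup>*\<^bsub>with_proj H\<^esub> w"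
    and card\<rho>: "card (\<rho> ` ?U) = card (components H)"
    using component_representatives[OF assms(1)] by blast
  obtain K where K: "\<And>i j. i \<rightarrow>\<^sup>*\<^bsub>with_proj H\<^esub> j \<Longrightarrow>
      (\<Prod>u\<in>?U. indet (XVar u)) ^ K * edge_binomial i j \<in> ?J"
    using reachable_binomial_in_ideal[OF assms(1) _ J H_edge] V by blast
  have "\<exists>u\<in>?U. \<exists>w\<in>?U. \<rho> u \<noteq> \<rho> w"
  proof (rule ccontr)
    assume "\<not> ?thesis"
    then have "\<forall>a\<in>\<rho> ` ?U. \<forall>b\<in>\<rho> ` ?U. a = b" by blast
    then have "card (\<rho> ` ?U) \<le> Suc 0"
      by (simp only: card_le_Suc0_iff_eq[OF finite_imageI[OF fin(1)]])
    then show False using card\<rho> r by simp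
  qed
  then obtain u w where uw: "u \<in> ?U" "w \<in> ?U" "\<rho> u \<noteq> \<rho> w" by blast
  let ?h = "\<Prod>u\<in>?U. indet (XVar u) :: ('v edge_var \<Rightarrow>\<^sub>0 nat) \<Rightarrow>\<^sub>0 'k"
  \<comment> \<open>the factor \<open>?h ^ K\<close> brings the binomials within a component into \<open>J\<close>, and a binomial joining two components brings \<open>x\<^sub>v\<close> and \<open>y\<^sub>v\<close> into the colon ideal\<close>
  let ?f = "?h ^ K * edge_binomial u w"
  let ?Q = "toric_kernel ?V {v} \<rho> :: (('v edge_var \<Rightarrow>\<^sub>0 nat) \<Rightarrow>\<^sub>0 'k) set"
  have hc: "?h ^ K \<in> carrier ?R"
    by (intro poly_ring_power_closed poly_ring_prod_closed X) (simp add: V)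
  have gc: "edge_binomial i j \<in> carrier ?R" if "i \<in> ?V" "j \<in> ?V" for i j
    using that by (rule edge_binomial_in_poly_ring)
  have Q_ass: "?Q \<in> associated_primes ?R ?J"
  proof (rule toric_kernel_associated[OF fin(2) J, where f = ?f])
    show "?J \<subseteq> ?Q"
    proof (intro J_least poly_ring_primeidealD(1) primeideal_toric_kernel)
      fix i j assume ij: "(i, j) \<in> parcs G"
      have "\<rho> i = \<rho> j" if "(i, j) \<in> parcs H"
        unfolding \<rho>[OF verts[OF that]] using that by (intro H.reachable_adjI) simp
      then show "edge_binomial i j \<in> ?Q"
        using G_edge[OF ij] by (auto simp: edge_binomial_in_toric_kernel_iff)
    qed
    show "?f \<in> carrier ?R" using uw V by (intro poly_ring_closed hc gc) simp_all
    have "monomial_map (toric_monomial {v} \<rho>) (edge_binomial u w :: _ \<Rightarrow>\<^sub>0 'k) \<noteq> 0"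
      using uw assms(3) by (auto simp: toric_map_edge_binomial_eq_0_iff)
    moreover have "monomial_map (toric_monomial {v} \<rho>) (indet (XVar i) :: _ \<Rightarrow>\<^sub>0 'k) \<noteq> 0" if "i \<in> ?U" for i
      using that assms(3) by (auto simp: toric_map_indet_eq_0_iff)
    ultimately have "monomial_map (toric_monomial {v} \<rho>) ?f \<noteq> 0"
      using fin(1) by (simp add: toric_map_mult toric_map_power toric_map_prod)
    then show "?f \<notin> ?Q" by (simp add: toric_kernel_def)
    show "indet x * ?f \<in> ?J" if "x \<in> edge_vars (?V \<inter> {v})" for x
    proof -
      have "indet x * edge_binomial u w \<in> ?J"
      proof -
        have "x = XVar v \<or> x = YVar v" using that by auto
        moreover have "u \<in> ?V" "w \<in> ?V" using uw V by simp_all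
        ultimately show ?thesis using apexX[of u w] apexY[of u w] by blast
      qed
      from poly_ring_idealD(5)[OF J hc this] show ?thesis by (simp add: mult_ac)
    qed
    show "edge_binomial i j * ?f \<in> ?J" if "i \<in> ?V - {v}" "j \<in> ?V - {v}" "\<rho> i = \<rho> j" for i j
    proof -
      have "i \<in> ?U" "j \<in> ?U" using that V by auto
      then have "?h ^ K * edge_binomial i j \<in> ?J" using \<rho>[of i j] that(3) by (intro K) simp
      moreover have "edge_binomial u w \<in> carrier ?R" using uw V by (intro gc) simp_all
      ultimately have "edge_binomial u w * (?h ^ K * edge_binomial i j) \<in> ?J"
        by (rule poly_ring_idealD(5)[OF J, rotated])
      then show ?thesis by (simp only: mult_ac)
    qed
  qed

  have eq: "height ?R ?P = height ?R ?Q"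
    by (rule assms(5)[unfolded unmixed_def edge_ring_eq, rule_format, OF P_ass Q_ass])
  \<comment> \<open>with equal heights for \<open>?P\<close> and \<open>?Q\<close>, this value is at least \<open>n\<close> and at most \<open>n + 2 - r\<close> for \<open>n\<close> vertices and \<open>r\<close> components of \<open>H\<close>\<close>
  have lower: "enat (card ?V - 1) \<le> height ?R ?P"
    using V by (intro height_toric_kernel_ge fin(2)) auto
  have upper: "height ?R ?Q \<le> enat (2 * card ?V - (card ?U + card (\<rho> ` ?U)))"
  proof (rule height_toric_kernel_le[OF fin(2)])
    show "inj_on \<rho> (\<rho> ` ?U)" using \<rho>\<rho> by (auto simp: inj_on_def)
  qed (use V \<rho>U assms(3) in auto)
  have "enat (card ?V - 1) \<le> enat (2 * card ?V - (card ?U + card (\<rho> ` ?U)))"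
    using lower[unfolded eq] upper by (rule order_trans)
  then have "card ?U \<le> 2 * Suc (card ?U) - (card ?U + card (components H))"
    unfolding cardV card\<rho> by simp
  moreover have "card (components H) \<le> card ?U"
    using card_image_le[OF fin(1), of \<rho>] card\<rho> by simp
  ultimately show False using r by arith
qed

end
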